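(* A first-order discretization of the continuous-time estimator $$\mathbb J\dot\varphi=\mathrm{ad}^*_\varphi\,\mathbb J\varphi-Z(\hat g,L^m,D,\bar a^m,\bar p)-\mathbb D\varphi,\qquad \hat\xi=\xi^m-\mathrm{Ad}_{\hat g^{-1}}\varphi,\qquad \dot{\hat g}=\hat g\,\hat\xi^\vee,$$ with $$Z=\begin{bmatrix} \Phi'\big(\mathcal U_r^0(\hat g,L^m,D)\big)S_\Gamma(\hat R)+\kappa\,\bar p^\times y \\ \kappa y \end{bmatrix},\qquad y=\bar p-\hat R\bar a^m-\hat b,$$ $\mathbb J=\mathrm{diag}(J,M)$ and $\mathbb D=\mathrm{diag}(\mathbb D_r,\mathbb D_t)$ (block diagonal), is given by $$(J\omega_i)^\times=\frac1{\Delta t}\big(F_i\mathcal J-\mathcal JF_i^T\big),$$ $$(M+\Delta t\,\mathbb D_t)\upsilon_{i+1}=F_i^TM\upsilon_i+\Delta t\,\kappa\big(\hat b_{i+1}+\hat R_{i+1}\bar a^m_{i+1}-\bar p_{i+1}\big),$$ $$(J+\Delta t\,\mathbb D_r)\omega_{i+1}=F_i^TJ\omega_i+\Delta t\,M\upsilon_{i+1}\times\upsilon_{i+1}+\Delta t\,\kappa\,\bar p_{i+1}^\times\big(\hat b_{i+1}+\hat R_{i+1}\bar a^m_{i+1}\big)-\Delta t\,\Phi'\big(\mathcal U^0_r(\hat g_{i+1},L^m_{i+1},D_{i+1})\big)S_{\Gamma_{i+1}}(\hat R_{i+1}),$$ $$\hat\xi_i=\xi^m_i-\mathrm{Ad}_{\hat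 g_i^{-1}}\varphi_i,\qquad \hat g_{i+1}=\hat g_i\exp(\Delta t\,\hat\xi_i^\vee),$$ where $F_i\in SO(3)$, $(\hat g(t_0),\hat\xi(t_0))=(\hat g_0,\hat\xi_0)$, $\varphi_i=[\omega_i^T, \upsilon_i^T]^T$, $\mathcal J=\frac12\mathrm{trace}(J)I-J$, and $S_{\Gamma_i}(\hat R_i)$ is the value of $S_\Gamma(\hat R)$ at time $t_i$.
   Context: $a^\times$ is the skew-symmetric matrix with $a^\times c=a\times c$; $\mathrm{vex}$ is the inverse of $a\mapsto a^\times$; $\langle A_1,A_2\rangle=\mathrm{trace}(A_1^TA_2)$. For $\zeta=[w^T, v^T]^T\in\mathbb R^6$: $\zeta^\vee=\begin{bmatrix} w^\times & v \\ 0 & 0 \end{bmatrix}$, $\mathrm{ad}_\zeta=\begin{bmatrix} w^\times & 0 \\ {v}^\times & w^\times \end{bmatrix}$, $\mathrm{ad}^*_\zeta=(\mathrm{ad}_\zeta)^T$; for $g=\begin{bmatrix} R & b \\ 0 & 1 \end{bmatrix}$, $\mathrm{Ad}_g=\begin{bmatrix} R & 0 \\ {b}^\times R & R \end{bmatrix}$. $\hat g=\begin{bmatrix} \hat R & \hat b \\ 0 & 1 \end{bmatrix}\in SE(3)$ and $\hat\xi\in\mathbb R^6$ are the pose and velocity estimates, $\varphi=[\omega^T, \upsilon^T]^T$. $D\in\mathbb R^{3\times n}$ (rank 3) is the matrix of vectors known in the inertial frame, $L^m$ the matrix of the corresponding body-frame measurements, $\bar p$ the mean of inertial positions of observed beacons,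 $\bar a^m$ the mean of their measured body-frame positions, $\xi^m$ the measured velocity. $W$ is a symmetric positive definite weight matrix, $\mathcal U^0_r(\hat g,L^m,D)=\frac12\langle D-\hat RL^m,(D-\hat RL^m)W\rangle$, $\Gamma=DW(L^m)^T$, $S_\Gamma(\hat R)=\mathrm{vex}(\Gamma\hat R^T-\hat R\Gamma^T)$. $\kappa>0$; $J,M,\mathbb D_r,\mathbb D_t\in\mathbb R^{3\times3}$ are positive definite ($J,M$ symmetric); $\Phi:[0,\infty)\to[0,\infty)$ is $C^2$ with $\Phi(0)=0$, $\Phi'>0$. The time interval is divided into steps $[t_i,t_{i+1}]$ of length $\Delta t$; subscript $i$ denotes values at $t_i$ (discrete approximations for the estimates). $F_i$ is the discrete attitude-error increment, $Q_{i+1}=Q_iF_i$ with $Q_i=R_i\hat R_i^T$, approximating $\exp(\Delta t\,\omega_i^\times)\approx I+\Delta t\,\omega_i^\times$, and is obtained by solving the first equation. "First-order" is the standard order of a one-step numerical integrator. *)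

theory Defs
  imports "HOL-Analysis.Analysis"
begin

definition pos_def :: "real^'n^'n \<Rightarrow> bool" where
  "pos_def A \<longleftrightarrow> (\<forall>x. x \<noteq> 0 \<longrightarrow> x \<bullet> (A *v x) > 0)"

definition sym_mat :: "real^'n^'n \<Rightarrow> bool" where
  "sym_mat A \<longleftrightarrow> transpose A = A"

definition frob :: "real^'n^'m \<Rightarrow> real^'n^'m \<Rightarrow> real" where
  "frob A B = trace (transpose A ** B)"

(* Neither the ring structure nor exp of the libraries applies to the type real^'n^'n
   (its multiplication is componentwise), hence the exponential series is spelled out. *)
definition mat_exp :: "real^'n^'n \<Rightarrow> real^'n^'n" where
  "mat_exp A = (\<Sum>k. (1 / fact k) *\<^sub>R (((\<lambda>B. A ** B) ^^ k) (mat 1)))"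

definition cross_mat :: "real^3 \<Rightarrow> real^3^3" where
  "cross_mat a = matrix (cross3 a)"

definition vex :: "real^3^3 \<Rightarrow> real^3" where
  "vex = inv cross_mat"

text \<open>
  Block vectors and block matrices are indexed by sum types: \<open>\<real>\<^sup>6\<close> is \<open>real^(3+3)\<close>, with the
  angular part first, and \<open>4 \<times> 4\<close> pose matrices have type \<open>real^(3+1)^(3+1)\<close>.
\<close>

definition block_vec :: "real^'a::finite \<Rightarrow> real^'b::finite \<Rightarrow> real^('a + 'b)" where
  "block_vec x y = (\<chi> i. case i of Inl a \<Rightarrow> x $ a | Inr b \<Rightarrow> y $ b)"

definition upper :: "real^('a::finite + 'b::finite) \<Rightarrow> real^'a" where
  "upper z = (\<chi> a. z $ Inl a)"

definition lower :: "real^('a::finite + 'b::finite) \<Rightarrow> real^'b" where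
  "lower z = (\<chi> b. z $ Inr b)"

definition block_mat ::
  "real^'c::finite^'a::finite \<Rightarrow> real^'d::finite^'a \<Rightarrow> real^'c^'b::finite \<Rightarrow> real^'d^'b \<Rightarrow> real^('c + 'd)^('a + 'b)" where
  "block_mat A B C E =
     (\<chi> i j. case i of
        Inl a \<Rightarrow> (case j of Inl c \<Rightarrow> A $ a $ c | Inr d \<Rightarrow> B $ a $ d)
      | Inr b \<Rightarrow> (case j of Inl c \<Rightarrow> C $ b $ c | Inr d \<Rightarrow> E $ b $ d))"

type_synonym pose = "real^(3+1)^(3+1)"
type_synonym twist = "real^(3+3)"

definition pose_of :: "real^3^3 \<Rightarrow> real^3 \<Rightarrow> pose" where
  "pose_of R b = block_mat R (columnvector b) 0 (mat 1)"

definition SE3 :: "pose set" where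
  "SE3 = {pose_of R b | R b. rotation_matrix R}"

definition rot :: "pose \<Rightarrow> real^3^3" where
  "rot g = (\<chi> i j. g $ Inl i $ Inl j)"

definition trans_part :: "pose \<Rightarrow> real^3" where
  "trans_part g = (\<chi> i. g $ Inl i $ Inr 1)"

definition vee :: "twist \<Rightarrow> pose" where
  "vee \<zeta> = block_mat (cross_mat (upper \<zeta>)) (columnvector (lower \<zeta>)) 0 0"

definition ad :: "twist \<Rightarrow> real^(3+3)^(3+3)" where
  "ad \<zeta> = block_mat (cross_mat (upper \<zeta>)) 0 (cross_mat (lower \<zeta>)) (cross_mat (upper \<zeta>))"

definition ad_star :: "twist \<Rightarrow> real^(3+3)^(3+3)" where
  "ad_star \<zeta> = transpose (ad \<zeta>)"

definition Ad :: "pose \<Rightarrow> real^(3+3)^(3+3)" where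
  "Ad g = block_mat (rot g) 0 (cross_mat (trans_part g) ** rot g) (rot g)"

definition U_rot :: "real^'n^'n \<Rightarrow> pose \<Rightarrow> real^'n^3 \<Rightarrow> real^'n^3 \<Rightarrow> real" where
  "U_rot W g L D = 1/2 * frob (D - rot g ** L) ((D - rot g ** L) ** W)"

definition S_Gamma :: "real^'n^'n \<Rightarrow> real^3^3 \<Rightarrow> real^'n^3 \<Rightarrow> real^'n^3 \<Rightarrow> real^3" where
  "S_Gamma W R L D =
     (let \<Gamma> = D ** W ** transpose L in vex (\<Gamma> ** transpose R - R ** transpose \<Gamma>))"

definition Z_term ::
  "(real \<Rightarrow> real) \<Rightarrow> real \<Rightarrow> real^'n^'n \<Rightarrow> pose \<Rightarrow> real^'n^3 \<Rightarrow> real^'n^3 \<Rightarrow> real^3 \<Rightarrow> real^3 \<Rightarrow> twist" where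
  "Z_term d\<Phi> \<kappa> W g L D a p =
     (let y = p - rot g *v a - trans_part g
      in block_vec (d\<Phi> (U_rot W g L D) *\<^sub>R S_Gamma W (rot g) L D + \<kappa> *\<^sub>R (cross_mat p *v y))
                   (\<kappa> *\<^sub>R y))"

(* The arguments xim, L, D, am, pbar are the measured signals as functions of time. *)
definition estimator_solution ::
  "real^3^3 \<Rightarrow> real^3^3 \<Rightarrow> real^3^3 \<Rightarrow> real^3^3 \<Rightarrow> real \<Rightarrow> real^'n^'n \<Rightarrow> (real \<Rightarrow> real) \<Rightarrow>
   (real \<Rightarrow> twist) \<Rightarrow> (real \<Rightarrow> real^'n^3) \<Rightarrow> (real \<Rightarrow> real^'n^3) \<Rightarrow> (real \<Rightarrow> real^3) \<Rightarrow> (real \<Rightarrow> real^3) \<Rightarrow>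
   real set \<Rightarrow> (real \<Rightarrow> pose) \<Rightarrow> (real \<Rightarrow> twist) \<Rightarrow> (real \<Rightarrow> twist) \<Rightarrow> bool" where
  "estimator_solution J M Dr Dt \<kappa> W d\<Phi> xim L D am pbar I g \<xi> \<phi> \<longleftrightarrow>
     (\<forall>t\<in>I.
        g t \<in> SE3 \<and>
        (\<exists>\<phi>'. (\<phi> has_vector_derivative \<phi>') (at t within I) \<and>
           block_mat J 0 0 M *v \<phi>' =
             ad_star (\<phi> t) *v (block_mat J 0 0 M *v \<phi> t)
             - Z_term d\<Phi> \<kappa> W (g t) (L t) (D t) (am t) (pbar t)
             - block_mat Dr 0 0 Dt *v \<phi> t) \<and>
        \<xi> t = xim t - Ad (matrix_inv (g t)) *v \<phi> t \<and>
        (g has_vector_derivative (g t ** vee (\<xi> t))) (at t within I))"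

text \<open>
  One step, of length \<open>h\<close>, from time \<open>t\<close> to time \<open>t + h\<close>; primed variables are the values at
  \<open>t + h\<close>. The equation for \<open>F\<close> has several solutions in SO(3) (for \<open>J = mat 1\<close>, rotations by
  \<open>\<theta>\<close> and by \<open>pi - \<theta>\<close> about the same axis are not distinguished); \<open>F\<close> is the one approximating
  the exponential of \<open>h\<close> times the skew matrix of the angular velocity, and \<open>\<epsilon>\<close> is the size of the
  neighbourhood in which it is sought.
\<close>

definition estimator_step ::
  "real^3^3 \<Rightarrow> real^3^3 \<Rightarrow> real^3^3 \<Rightarrow> real^3^3 \<Rightarrow> real \<Rightarrow> real^'n^'n \<Rightarrow> (real \<Rightarrow> real) \<Rightarrow>
   (real \<Rightarrow> twist) \<Rightarrow> (real \<Rightarrow> real^'n^3) \<Rightarrow> (real \<Rightarrow> real^'n^3) \<Rightarrow> (real \<Rightarrow> real^3) \<Rightarrow> (real \<Rightarrow> real^3) \<Rightarrow>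
   real \<Rightarrow> real \<Rightarrow> real \<Rightarrow> pose \<times> twist \<times> twist \<Rightarrow> pose \<times> twist \<times> twist \<Rightarrow> bool" where
  "estimator_step J M Dr Dt \<kappa> W d\<Phi> xim L D am pbar \<epsilon> t h = (\<lambda>(g, \<xi>, \<phi>) (g', \<xi>', \<phi>').
     let \<omega> = upper \<phi>; \<upsilon> = lower \<phi>; \<omega>' = upper \<phi>'; \<upsilon>' = lower \<phi>';
         R' = rot g'; b' = trans_part g'; t' = t + h;
         \<J> = (1/2 * trace J) *\<^sub>R mat 1 - J
     in \<exists>F. rotation_matrix F \<and> norm (F - mat_exp (h *\<^sub>R cross_mat \<omega>)) < \<epsilon> \<and>
        cross_mat (J *v \<omega>) = (1 / h) *\<^sub>R (F ** \<J> - \<J> ** transpose F) \<and>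
        (M + h *\<^sub>R Dt) *v \<upsilon>' =
          transpose F *v (M *v \<upsilon>) + (h * \<kappa>) *\<^sub>R (b' + R' *v am t' - pbar t') \<and>
        (J + h *\<^sub>R Dr) *v \<omega>' =
          transpose F *v (J *v \<omega>) + h *\<^sub>R cross3 (M *v \<upsilon>') \<upsilon>'
          + (h * \<kappa>) *\<^sub>R (cross_mat (pbar t') *v (b' + R' *v am t'))
          - (h * d\<Phi> (U_rot W g' (L t') (D t'))) *\<^sub>R S_Gamma W R' (L t') (D t') \<and>
        \<xi> = xim t - Ad (matrix_inv g) *v \<phi> \<and>
        \<xi>' = xim t' - Ad (matrix_inv g') *v \<phi>' \<and>
        g' = g ** mat_exp (h *\<^sub>R vee \<xi>))"

text \<open>
  A possibly implicit one-step method is a relation \<open>step t h x x'\<close> between the approximations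
  \<open>x\<close> at \<open>t\<close> and \<open>x'\<close> at \<open>t + h\<close>. It has order \<open>p\<close> along the exact solution \<open>y\<close> if, for small steps,
  the step from an exact value is solvable with local error \<open>O(h\<^sup>p\<^sup>+\<^sup>1)\<close>, and the method started
  at \<open>y t0\<close> can be run over the whole interval with global error \<open>O(h\<^sup>p)\<close>.
\<close>

definition one_step_order ::
  "nat \<Rightarrow> (real \<Rightarrow> real \<Rightarrow> 'a \<Rightarrow> 'a \<Rightarrow> bool) \<Rightarrow> (real \<Rightarrow> 'a::real_normed_vector) \<Rightarrow> real \<Rightarrow> real \<Rightarrow> bool"
where
  "one_step_order p step y t0 T \<longleftrightarrow>
     (\<exists>C h0. 0 < h0 \<and>
        (\<forall>t h. 0 < h \<and> h \<le> h0 \<and> t0 \<le> t \<and> t + h \<le> T \<longrightarrow>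
           (\<exists>x'. step t h (y t) x') \<and>
           (\<forall>x'. step t h (y t) x' \<longrightarrow> norm (x' - y (t + h)) \<le> C * h ^ (p + 1))) \<and>
        (\<forall>N>0. let h = (T - t0) / real N; \<tau> = (\<lambda>i. t0 + real i * h);
                   run = (\<lambda>x. x 0 = y t0 \<and> (\<forall>i<N. step (\<tau> i) h (x i) (x (Suc i))))
               in h \<le> h0 \<longrightarrow>
                  (\<exists>x. run x) \<and>
                  (\<forall>x. run x \<longrightarrow> (\<forall>i\<le>N. norm (x i - y (\<tau> i)) \<le> C * h ^ p))))"

end

(* Starting from a state near the exact one, every quantity of a step is a bounded and Lipschitz
   function of the state and the measurements, so one step agrees with the explicit Euler step of
   the estimator up to O(h^2); a discrete Gronwall argument then gives the order. The only implicit
   part is F. Orthogonality of F = I + A makes the symmetric part of A quadratically small, and the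
   equation for F then forces A = h * omega^x + O(|A|^2), so any solution F near the exponential has
   the right expansion and uniqueness of F is not needed. Existence of F comes from Brouwer's theorem
   in Cayley coordinates. The numerical pose need not be known to lie in SE(3): staying close to the
   exact pose keeps it uniformly invertible. *)
theory Submission
  imports Defs
begin

section \<open>Uniform bounds over a family of steps\<close>

text \<open>The velocity estimate has no dynamics of its own: each step ties \<open>\<xi>\<close>
  algebraically to the pose and \<open>\<phi>\<close>. It is therefore carried as an invariant, and
  errors are propagated only in the pose and in the two halves of \<open>\<phi>\<close>. Once
  \<open>F\<close> is given, a step is triangular: the new pose is explicit, the new linear velocity
  depends on it, and the new angular velocity depends on both. The delicate point is circularity.
  The Lipschitz constants hold only near the exact solution, whereas nearness at a later step is
  what the estimate has to yield. An error recursion with factor \<open>1 + L * h\<close> closes the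
  induction, so no step may lose a constant by passing to an equivalent norm, and all constants must
  be uniform in time, state and step size. Such uniformity is expressed by O-bounds over an index
  set whose elements are whole steps. The signals are only Lipschitz, so the exact solution has
  merely a Lipschitz derivative; this just suffices for a remainder of size
  \<open>h^2\<close>.\<close>

text \<open>
  The index set ranges over all admissible steps (or pairs of times) at once: a bound in terms of
  the step size \<open>r q\<close> then has a constant that is uniform in time, state and step.
\<close>

definition ubigo :: "'q set \<Rightarrow> ('q \<Rightarrow> real) \<Rightarrow> ('q \<Rightarrow> 'b::real_normed_vector) \<Rightarrow> bool" where
  "ubigo Q r f \<longleftrightarrow> (\<exists>C\<ge>0. \<forall>q\<in>Q. norm (f q) \<le> C * r q)"

abbreviation ubounded :: "'q set \<Rightarrow> ('q \<Rightarrow> 'b::real_normed_vector) \<Rightarrow> bool" where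
  "ubounded Q \<equiv> ubigo Q (\<lambda>_. 1)"

text \<open>Replacing both factors of a product by O(r)-close ones changes the product by O(r) only
  if the factors are bounded. With boundedness built in, closeness passes through every bilinear
  operation, and the right-hand sides can be treated term by term.\<close>

definition uclose ::
  "'q set \<Rightarrow> ('q \<Rightarrow> real) \<Rightarrow> ('q \<Rightarrow> 'b::real_normed_vector) \<Rightarrow> ('q \<Rightarrow> 'b) \<Rightarrow> bool" where
  "uclose Q r f g \<longleftrightarrow> ubounded Q f \<and> ubounded Q g \<and> ubigo Q r (\<lambda>q. f q - g q)"

lemma ubigoI: "(\<And>q. q \<in> Q \<Longrightarrow> norm (f q) \<le> C * r q) \<Longrightarrow> 0 \<le> C \<Longrightarrow> ubigo Q r f"
  unfolding ubigo_def by blast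

lemma ubigoE:
  assumes "ubigo Q r f"
  obtains C where "0 \<le> C" "\<And>q. q \<in> Q \<Longrightarrow> norm (f q) \<le> C * r q"
  using assms unfolding ubigo_def by blast

lemma ubigo_cong:
  assumes "ubigo Q r f" "\<And>q. q \<in> Q \<Longrightarrow> f q = g q"
  shows "ubigo Q r g"
  using assms unfolding ubigo_def by metis

lemma ubigo_add:
  assumes "ubigo Q r f" "ubigo Q r g"
  shows "ubigo Q r (\<lambda>q. f q + g q)"
proof -
  from assms obtain A B where AB: "0 \<le> A" "\<And>q. q \<in> Q \<Longrightarrow> norm (f q) \<le> A * r q"
    "0 \<le> B" "\<And>q. q \<in> Q \<Longrightarrow> norm (g q) \<le> B * r q" by (metis ubigoE)
  show ?thesis
  proof (rule ubigoI[where C="A+B"])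
    fix q assume "q \<in> Q"
    then show "norm (f q + g q) \<le> (A+B) * r q"
      using AB norm_triangle_ineq[of "f q" "g q"] by (fastforce simp: algebra_simps)
  qed (use AB in simp)
qed

lemma ubigo_linear:
  assumes "bounded_linear T" "ubigo Q r f"
  shows "ubigo Q r (\<lambda>q. T (f q))"
proof -
  from assms obtain A where A: "0 \<le> A" "\<And>q. q \<in> Q \<Longrightarrow> norm (f q) \<le> A * r q" by (metis ubigoE)
  obtain K where K: "0 \<le> K" "\<And>x. norm (T x) \<le> norm x * K"
    using bounded_linear.nonneg_bounded[OF assms(1)] by blast
  show ?thesis
  proof (rule ubigoI[where C="A*K"])
    fix q assume "q \<in> Q"
    then have "norm (f q) * K \<le> A * r q * K" using A K by (intro mult_right_mono) auto
    then show "norm (T (f q)) \<le> A * K * r q" using K(2)[of "f q"] by (simp add: algebra_simps)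
  qed (use A K in simp)
qed

lemma ubigo_minus: "ubigo Q r f \<Longrightarrow> ubigo Q r (\<lambda>q. - f q)"
  unfolding ubigo_def by simp

lemma ubigo_diff: "ubigo Q r f \<Longrightarrow> ubigo Q r g \<Longrightarrow> ubigo Q r (\<lambda>q. f q - g q)"
  using ubigo_add[OF _ ubigo_minus, of Q r f g] by simp

lemma ubigo_bilinear:
  assumes "bounded_bilinear b" "ubigo Q r f" "ubigo Q s g"
  shows "ubigo Q (\<lambda>q. r q * s q) (\<lambda>q. b (f q) (g q))"
proof -
  from assms obtain A B where AB: "0 \<le> A" "\<And>q. q \<in> Q \<Longrightarrow> norm (f q) \<le> A * r q"
    "0 \<le> B" "\<And>q. q \<in> Q \<Longrightarrow> norm (g q) \<le> B * s q" by (metis ubigoE)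
  obtain K where K: "0 \<le> K" "\<And>x y. norm (b x y) \<le> norm x * norm y * K"
    using bounded_bilinear.nonneg_bounded[OF assms(1)] by blast
  show ?thesis
  proof (rule ubigoI[where C="A*B*K"])
    fix q assume q: "q \<in> Q"
    have "norm (f q) * norm (g q) \<le> (A * r q) * (B * s q)"
      by (rule mult_mono[OF AB(2)[OF q] AB(4)[OF q] order_trans[OF norm_ge_zero AB(2)[OF q]] norm_ge_zero])
    then have "norm (f q) * norm (g q) * K \<le> (A * r q) * (B * s q) * K"
      by (intro mult_right_mono K)
    then show "norm (b (f q) (g q)) \<le> A * B * K * (r q * s q)"
      using K(2)[of "f q" "g q"] by (simp add: algebra_simps)
  qed (use AB K in simp)
qed

lemma ubigo_bilinear_left:
  "bounded_bilinear b \<Longrightarrow> ubigo Q r f \<Longrightarrow> ubounded Q g \<Longrightarrow> ubigo Q r (\<lambda>q. b (f q) (g q))"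
  using ubigo_bilinear[of b Q r f "\<lambda>_. 1" g] by simp

lemma ubigo_bilinear_right:
  "bounded_bilinear b \<Longrightarrow> ubounded Q f \<Longrightarrow> ubigo Q r g \<Longrightarrow> ubigo Q r (\<lambda>q. b (f q) (g q))"
  using ubigo_bilinear[of b Q "\<lambda>_. 1" f r g] by simp

lemma ubigo_mono:
  assumes "ubigo Q r f" "\<And>q. q \<in> Q \<Longrightarrow> r q \<le> s q"
  shows "ubigo Q s f"
proof -
  from assms obtain A where A: "0 \<le> A" "\<And>q. q \<in> Q \<Longrightarrow> norm (f q) \<le> A * r q" by (metis ubigoE)
  show ?thesis
    using A assms(2) by (intro ubigoI[where C=A]) (meson mult_left_mono order_trans)+
qed

lemma ubigo_const: "ubounded Q (\<lambda>_. c)"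
  by (rule ubigoI[where C="norm c"]) auto

lemma ubigo_scaleR:
  assumes "ubigo Q r f" "\<And>q. q \<in> Q \<Longrightarrow> 0 \<le> h q"
  shows "ubigo Q (\<lambda>q. h q * r q) (\<lambda>q. h q *\<^sub>R f q)"
proof -
  have "ubigo Q h h" by (rule ubigoI[where C=1]) (use assms in auto)
  then show ?thesis using assms ubigo_bilinear[OF bounded_bilinear_scaleR] by blast
qed

lemma ucloseI: "ubounded Q f \<Longrightarrow> ubounded Q g \<Longrightarrow> ubigo Q r (\<lambda>q. f q - g q) \<Longrightarrow> uclose Q r f g"
  by (simp add: uclose_def)

lemma ucloseD:
  assumes "uclose Q r f g"
  shows "ubounded Q f" "ubounded Q g" "ubigo Q r (\<lambda>q. f q - g q)"
  using assms by (simp_all add: uclose_def)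

text \<open>For \<open>r\<close> constantly 1, closeness adds nothing to boundedness, so every
  closeness rule doubles as a boundedness rule.\<close>

lemma uclose_refl: "ubounded Q f \<Longrightarrow> uclose Q (\<lambda>_. 1) f f"
  by (intro ucloseI) (auto intro!: ubigoI[where C=0])

lemma uclose_const: "uclose Q r (\<lambda>_. c) (\<lambda>_. c)"
  by (intro ucloseI ubigo_const ubigoI[where C=0]) auto

lemma uclose_add:
  assumes "uclose Q r f1 f2" "uclose Q r g1 g2"
  shows "uclose Q r (\<lambda>q. f1 q + g1 q) (\<lambda>q. f2 q + g2 q)"
proof (rule ucloseI)
  show "ubigo Q r (\<lambda>q. f1 q + g1 q - (f2 q + g2 q))"
    using ubigo_add[OF ucloseD(3)[OF assms(1)] ucloseD(3)[OF assms(2)]] by (simp add: algebra_simps)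
qed (use ubigo_add ucloseD[OF assms(1)] ucloseD[OF assms(2)] in blast)+

lemma uclose_linear:
  assumes "bounded_linear T" "uclose Q r f1 f2"
  shows "uclose Q r (\<lambda>q. T (f1 q)) (\<lambda>q. T (f2 q))"
proof (rule ucloseI)
  interpret bounded_linear T by fact
  show "ubigo Q r (\<lambda>q. T (f1 q) - T (f2 q))"
    using ubigo_linear[OF assms(1) ucloseD(3)[OF assms(2)]] by (simp add: diff)
  show "ubounded Q (\<lambda>q. T (f1 q))" "ubounded Q (\<lambda>q. T (f2 q))"
    by (rule ubigo_linear[OF assms(1)], rule ucloseD[OF assms(2)])+
qed

lemma uclose_minus: "uclose Q r f1 f2 \<Longrightarrow> uclose Q r (\<lambda>q. - f1 q) (\<lambda>q. - f2 q)"
  by (rule uclose_linear[OF bounded_linear_minus[OF bounded_linear_ident]])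

lemma uclose_diff:
  "uclose Q r f1 f2 \<Longrightarrow> uclose Q r g1 g2 \<Longrightarrow> uclose Q r (\<lambda>q. f1 q - g1 q) (\<lambda>q. f2 q - g2 q)"
  using uclose_add[OF _ uclose_minus, of Q r f1 f2 g1 g2] by simp

lemma uclose_bilinear:
  assumes "bounded_bilinear b" "uclose Q r f1 f2" "uclose Q r g1 g2"
  shows "uclose Q r (\<lambda>q. b (f1 q) (g1 q)) (\<lambda>q. b (f2 q) (g2 q))"
proof (rule ucloseI)
  interpret bounded_bilinear b by fact
  note D = ucloseD[OF assms(2)] ucloseD[OF assms(3)]
  have "ubigo Q r (\<lambda>q. b (f1 q - f2 q) (g1 q) + b (f2 q) (g1 q - g2 q))"
    by (rule ubigo_add[OF ubigo_bilinear_left[OF assms(1) D(3) D(4)]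
          ubigo_bilinear_right[OF assms(1) D(2) D(6)]])
  then show "ubigo Q r (\<lambda>q. b (f1 q) (g1 q) - b (f2 q) (g2 q))"
    by (simp add: diff_left diff_right)
  show "ubounded Q (\<lambda>q. b (f1 q) (g1 q))" "ubounded Q (\<lambda>q. b (f2 q) (g2 q))"
    by (rule ubigo_bilinear_left[OF assms(1) D(1) D(4)])
       (rule ubigo_bilinear_left[OF assms(1) D(2) D(5)])
qed

lemma uclose_sym: "uclose Q r f g \<Longrightarrow> uclose Q r g f"
  unfolding uclose_def ubigo_def by (simp add: norm_minus_commute)

text \<open>With \<open>r\<close> at most 1, \<open>f\<close> inherits boundedness from
  \<open>g\<close>. In this way the new values of a step become bounded without an a priori
  estimate.\<close>

lemma uclose_perturb:
  assumes "ubounded Q g" "ubigo Q r (\<lambda>q. f q - g q)" "\<And>q. q \<in> Q \<Longrightarrow> r q \<le> 1"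
  shows "uclose Q r f g"
proof (rule ucloseI[OF _ assms(1,2)])
  show "ubounded Q f" using ubigo_add[OF assms(1) ubigo_mono[OF assms(2), of "\<lambda>_. 1"]] assms(3) by simp
qed


section \<open>Convergence of one-step methods\<close>

text \<open>Nearness and the error bound are proved together, since the recursion is available only
  while \<open>e t x\<close> is at most \<open>\<delta>\<close>. \<open>P\<close> is an invariant of
  the states in a run, and \<open>e\<close> may ignore components that \<open>P\<close> determines;
  \<open>near\<close> converts back to the norm of the state space.\<close>

lemma one_step_order_1I:
  fixes step :: "real \<Rightarrow> real \<Rightarrow> 'a::real_normed_vector \<Rightarrow> 'a \<Rightarrow> bool" and y :: "real \<Rightarrow> 'a"
    and e :: "real \<Rightarrow> 'a \<Rightarrow> real"
  assumes pos: "0 < \<delta>" "0 < h1" "0 \<le> K" "0 \<le> L" "0 \<le> C" "t0 < T"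
    and y: "\<And>t. t \<in> {t0..T} \<Longrightarrow> P t (y t)" "\<And>t. t \<in> {t0..T} \<Longrightarrow> e t (y t) = 0"
    and near: "\<And>t x. t \<in> {t0..T} \<Longrightarrow> P t x \<Longrightarrow> e t x \<le> \<delta> \<Longrightarrow> norm (x - y t) \<le> K * e t x"
    and solvable: "\<And>t h x. 0 < h \<Longrightarrow> h \<le> h1 \<Longrightarrow> t0 \<le> t \<Longrightarrow> t + h \<le> T \<Longrightarrow> P t x \<Longrightarrow> e t x \<le> \<delta> \<Longrightarrow>
        \<exists>x'. step t h x x'"
    and stable: "\<And>t h x x'. 0 < h \<Longrightarrow> h \<le> h1 \<Longrightarrow> t0 \<le> t \<Longrightarrow> t + h \<le> T \<Longrightarrow> P t x \<Longrightarrow> e t x \<le> \<delta> \<Longrightarrow>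
        step t h x x' \<Longrightarrow> P (t + h) x' \<and> e (t + h) x' \<le> (1 + L * h) * e t x + C * h\<^sup>2"
  shows "one_step_order 1 step y t0 T"
proof -
  \<comment> \<open>The recursion gives an error of at most
    \<open>exp (L * i * h) * i * C * h^2\<close> after \<open>i\<close> steps, hence
    \<open>C1 * h\<close> because \<open>i * h\<close> is at most \<open>T - t0\<close>. In
    \<open>h0\<close> below, the extra \<open>C\<close> covers the local error of a single step and
    the 1 avoids division by zero.\<close>
  define C1 where "C1 = exp (L * (T - t0)) * (T - t0) * C"
  have C1: "0 \<le> C1" using pos by (simp add: C1_def)
  define h0 where "h0 = min h1 (min 1 (\<delta> / (C1 + C + 1)))"
  have h0: "0 < h0" "h0 \<le> h1" "h0 \<le> 1" using pos C1 by (auto simp: h0_def)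
  have small: "(C1 + C) * h \<le> \<delta>" if "0 < h" "h \<le> h0" for h
  proof -
    have "h \<le> \<delta> / (C1 + C + 1)" using that by (simp add: h0_def)
    then have "(C1 + C + 1) * h \<le> \<delta>" using C1 pos by (simp add: field_simps)
    then show ?thesis using that by (simp add: algebra_simps)
  qed
  have local: "norm (x' - y (t + h)) \<le> K * (C1 + C) * h ^ (1 + 1)"
    if "0 < h" "h \<le> h0" "t0 \<le> t" "t + h \<le> T" "step t h (y t) x'" for t h x'
  proof -
    have t: "t \<in> {t0..T}" "t + h \<in> {t0..T}" using that by auto
    have "P (t + h) x' \<and> e (t + h) x' \<le> (1 + L * h) * e t (y t) + C * h\<^sup>2"
      using that h0 y t pos by (intro stable) auto
    then have *: "P (t + h) x'" "e (t + h) x' \<le> C * h\<^sup>2" using y t by auto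
    have hh: "h\<^sup>2 \<le> h" using that h0 by (simp add: power2_eq_square)
    have "C * h\<^sup>2 \<le> (C1 + C) * h" using hh C1 pos that by (intro mult_mono) auto
    then have "norm (x' - y (t + h)) \<le> K * e (t + h) x'"
      using small[OF that(1,2)] * t by (intro near) auto
    also have "\<dots> \<le> K * ((C1 + C) * h\<^sup>2)"
      using * C1 pos by (intro mult_left_mono order_trans[OF *(2)] mult_right_mono) auto
    finally show ?thesis by (simp add: power2_eq_square algebra_simps)
  qed
  have global: "(\<exists>x. x 0 = y t0 \<and> (\<forall>i<N. step (t0 + real i * h) h (x i) (x (Suc i)))) \<and>
      (\<forall>x. x 0 = y t0 \<and> (\<forall>i<N. step (t0 + real i * h) h (x i) (x (Suc i))) \<longrightarrow>
        (\<forall>i\<le>N. norm (x i - y (t0 + real i * h)) \<le> K * (C1 + C) * h ^ 1))"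
    if N: "N > 0" and h: "h = (T - t0) / real N" "h \<le> h0" for N h
  proof -
    have hpos: "0 < h" using N h pos by simp
    have ih: "real i * h \<le> T - t0" if "i \<le> N" for i
    proof -
      have "real i * h \<le> real N * h" using that hpos by (intro mult_right_mono) auto
      then show ?thesis using h N by simp
    qed
    \<comment> \<open>The clause for \<open>i = 0\<close> pins the starting value when a run is
      built by dependent choice. The guard \<open>i \<le> N\<close> makes \<open>G\<close> vacuous
      beyond the last step, so the choice can go on for all \<open>i\<close>.\<close>
    define G where "G i x \<longleftrightarrow> (i = 0 \<longrightarrow> x = y t0) \<and> (i \<le> N \<longrightarrow> P (t0 + real i * h) x \<and>
        e (t0 + real i * h) x \<le> exp (L * (real i * h)) * (real i * (C * h\<^sup>2)))" for i x
    have bnd: "exp (L * (real i * h)) * (real i * (C * h\<^sup>2)) \<le> C1 * h" if "i \<le> N" for i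
    proof -
      have "exp (L * (real i * h)) * ((real i * h) * (C * h)) \<le> exp (L * (T - t0)) * ((T - t0) * (C * h))"
        using ih[OF that] pos hpos by (intro mult_mono) (auto intro!: mult_left_mono)
      then show ?thesis by (simp add: C1_def power2_eq_square algebra_simps)
    qed
    have G_near: "P (t0 + real i * h) x" "e (t0 + real i * h) x \<le> C1 * h" "e (t0 + real i * h) x \<le> \<delta>"
      if "G i x" "i \<le> N" for i x
    proof -
      show "P (t0 + real i * h) x" using that by (simp add: G_def)
      show *: "e (t0 + real i * h) x \<le> C1 * h" using that bnd[of i] by (auto simp: G_def)
      have "C1 * h \<le> (C1 + C) * h" using hpos pos by (intro mult_right_mono) auto
      then show "e (t0 + real i * h) x \<le> \<delta>" using * small[OF hpos h(2)] by linarith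
    qed
    have t_Suc: "t0 + real (Suc i) * h = (t0 + real i * h) + h" for i by (simp add: algebra_simps)
    have tN: "t0 \<le> t0 + real i * h" "(t0 + real i * h) + h \<le> T" if "i < N" for i
      using hpos ih[of "Suc i"] that by (auto simp: algebra_simps)
    have G_step: "G (Suc i) x'" if "G i x" "i < N" "step (t0 + real i * h) h x x'" for i x x'
    proof -
      let ?t = "t0 + real i * h"
      have *: "P (?t + h) x' \<and> e (?t + h) x' \<le> (1 + L * h) * e ?t x + C * h\<^sup>2"
        using that G_near[of i x] tN[of i] h h0 hpos by (intro stable) auto
      have Lh: "1 + L * h \<le> exp (L * h)" by (rule exp_ge_add_one_self)
      have "(1 + L * h) * e ?t x \<le> (1 + L * h) * (exp (L * (real i * h)) * (real i * (C * h\<^sup>2)))"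
        using that pos hpos by (intro mult_left_mono) (auto simp: G_def)
      also have "\<dots> \<le> exp (L * h) * (exp (L * (real i * h)) * (real i * (C * h\<^sup>2)))"
        using Lh pos by (intro mult_right_mono) auto
      also have "\<dots> = exp (L * (real (Suc i) * h)) * (real i * (C * h\<^sup>2))"
        by (simp add: exp_add[symmetric] algebra_simps)
      finally have 1: "(1 + L * h) * e ?t x \<le> exp (L * (real (Suc i) * h)) * (real i * (C * h\<^sup>2))" .
      have "1 * (C * h\<^sup>2) \<le> exp (L * (real (Suc i) * h)) * (C * h\<^sup>2)"
        using pos hpos by (intro mult_right_mono) auto
      then have "e (?t + h) x' \<le> exp (L * (real (Suc i) * h)) * (real (Suc i) * (C * h\<^sup>2))"
        using 1 * by (simp add: algebra_simps)
      then show ?thesis using * unfolding G_def t_Suc by simp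
    qed
    have G0: "G 0 (y t0)" using y pos by (simp add: G_def)
    have "\<exists>x. \<forall>i. G i (x i) \<and> (i < N \<longrightarrow> step (t0 + real i * h) h (x i) (x (Suc i)))"
    proof (rule dependent_nat_choice)
      show "\<exists>x. G 0 x" using G0 by blast
      fix x i assume "G i x"
      show "\<exists>x'. G (Suc i) x' \<and> (i < N \<longrightarrow> step (t0 + real i * h) h x x')"
      proof (cases "i < N")
        case True
        then obtain x' where "step (t0 + real i * h) h x x'"
          using \<open>G i x\<close> G_near[of i x] tN[of i] h h0 hpos solvable[of h "t0 + real i * h" x] by auto
        then show ?thesis using G_step True \<open>G i x\<close> by blast
      qed (auto simp: G_def)
    qed
    then obtain x where x: "\<And>i. G i (x i)" "\<And>i. i < N \<Longrightarrow> step (t0 + real i * h) h (x i) (x (Suc i))"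
      by blast
    have "x 0 = y t0" using x(1)[of 0] by (simp add: G_def)
    \<comment> \<open>The bound is shown for every run and not just for the chosen one, since the
      step relation may be multivalued.\<close>
    moreover have "norm (x i - y (t0 + real i * h)) \<le> K * (C1 + C) * h ^ 1"
      if run: "x 0 = y t0" "\<forall>i<N. step (t0 + real i * h) h (x i) (x (Suc i))" and "i \<le> N" for x i
    proof -
      have "G i (x i)" using \<open>i \<le> N\<close>
      proof (induction i)
        case 0 then show ?case using G0 run by simp
      next
        case (Suc i) then show ?case using G_step[of i "x i" "x (Suc i)"] run by simp
      qed
      note G = G_near[OF this \<open>i \<le> N\<close>]
      have "t0 + real i * h \<in> {t0..T}" using ih[OF \<open>i \<le> N\<close>] hpos by auto
      then have "norm (x i - y (t0 + real i * h)) \<le> K * e (t0 + real i * h) (x i)"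
        using G by (intro near) auto
      also have "\<dots> \<le> K * ((C1 + C) * h)"
        using G pos hpos by (intro mult_left_mono order_trans[OF G(2)] mult_right_mono) auto
      finally show ?thesis by simp
    qed
    ultimately show ?thesis using x(2) by blast
  qed
  show ?thesis
    unfolding one_step_order_def Let_def
  proof (rule exI[of _ "K * (C1 + C)"], rule exI[of _ h0], intro conjI allI impI h0)
    fix t h assume *: "0 < h \<and> h \<le> h0 \<and> t0 \<le> t \<and> t + h \<le> T"
    then have "t \<in> {t0..T}" by auto
    then show "\<exists>x'. step t h (y t) x'" using * h0 y pos by (intro solvable) auto
    fix x' assume "step t h (y t) x'"
    then show "norm (x' - y (t + h)) \<le> K * (C1 + C) * h ^ (1 + 1)" using * local by blast
  next
    fix N :: nat assume N: "0 < N" "(T - t0) / real N \<le> h0"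
    show "\<exists>x. x 0 = y t0 \<and> (\<forall>i<N. step (t0 + real i * ((T - t0) / real N)) ((T - t0) / real N) (x i) (x (Suc i)))"
      using global[OF N(1) refl N(2)] by blast
  next
    fix N :: nat and x i assume N: "0 < N" "(T - t0) / real N \<le> h0"
      and "x 0 = y t0 \<and> (\<forall>i<N. step (t0 + real i * ((T - t0) / real N)) ((T - t0) / real N) (x i) (x (Suc i)))"
      and "i \<le> N"
    then show "norm (x i - y (t0 + real i * ((T - t0) / real N))) \<le> K * (C1 + C) * ((T - t0) / real N) ^ 1"
      using global[OF N(1) refl N(2)] by blast
  qed
qed

section \<open>Matrices and block matrices\<close>

lemma bounded_bilinear_matrix_mult:
  "bounded_bilinear ((**) :: real^'n^'m \<Rightarrow> real^'p^'n \<Rightarrow> real^'p^'m)"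
  by (subst bilinear_conv_bounded_bilinear[symmetric])
     (auto simp: bilinear_def linear_iff matrix_matrix_mult_def vec_eq_iff algebra_simps
       sum.distrib sum_distrib_left)

lemma bounded_bilinear_matrix_vector_mult:
  "bounded_bilinear ((*v) :: real^'n^'m \<Rightarrow> real^'n \<Rightarrow> real^'m)"
  by (subst bilinear_conv_bounded_bilinear[symmetric])
     (auto simp: bilinear_def linear_iff matrix_vector_mult_def vec_eq_iff algebra_simps
       sum.distrib sum_distrib_left)

lemma bounded_bilinear_cross3: "bounded_bilinear cross3"
  using bilinear_cross by (simp add: bilinear_conv_bounded_bilinear)

lemma bounded_linear_transpose: "bounded_linear (transpose :: real^'n^'m \<Rightarrow> real^'m^'n)"
  by (subst linear_conv_bounded_linear[symmetric]) (auto simp: linear_iff transpose_def vec_eq_iff)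

lemma bounded_linear_rot: "bounded_linear rot"
  by (subst linear_conv_bounded_linear[symmetric]) (auto simp: linear_iff rot_def vec_eq_iff)

lemma bounded_linear_trans_part: "bounded_linear trans_part"
  by (subst linear_conv_bounded_linear[symmetric]) (auto simp: linear_iff trans_part_def vec_eq_iff)

lemma bounded_linear_upper: "bounded_linear upper"
  by (subst linear_conv_bounded_linear[symmetric]) (auto simp: linear_iff upper_def vec_eq_iff)

lemma bounded_linear_lower: "bounded_linear lower"
  by (subst linear_conv_bounded_linear[symmetric]) (auto simp: linear_iff lower_def vec_eq_iff)

lemma bounded_linear_trace: "bounded_linear (trace :: real^'n^'n \<Rightarrow> real)"
  by (subst linear_conv_bounded_linear[symmetric])
     (auto simp: linear_iff trace_def sum.distrib sum_distrib_left)

section \<open>Block vectors and block matrices\<close>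

lemma upper_block_vec [simp]: "upper (block_vec x y) = x"
  and lower_block_vec [simp]: "lower (block_vec x y) = y"
  by (simp_all add: upper_def lower_def block_vec_def vec_eq_iff)

lemma block_vec_upper_lower [simp]: "block_vec (upper z) (lower z) = z"
  by (simp add: upper_def lower_def block_vec_def vec_eq_iff split: sum.split)

lemma block_vec_eq_iff [simp]: "block_vec x y = block_vec x' y' \<longleftrightarrow> x = x' \<and> y = y'"
  by (metis upper_block_vec lower_block_vec)

lemma block_vec_add: "block_vec x y + block_vec x' y' = block_vec (x + x') (y + y')"
  and block_vec_diff: "block_vec x y - block_vec x' y' = block_vec (x - x') (y - y')"
  by (simp_all add: block_vec_def vec_eq_iff split: sum.split)

lemma bounded_linear_block_vec_left: "bounded_linear (\<lambda>x. block_vec x 0)"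
  by (subst linear_conv_bounded_linear[symmetric])
     (auto simp: linear_iff block_vec_def vec_eq_iff split: sum.split)

lemma bounded_linear_block_vec_right: "bounded_linear (\<lambda>x. block_vec 0 x)"
  by (subst linear_conv_bounded_linear[symmetric])
     (auto simp: linear_iff block_vec_def vec_eq_iff split: sum.split)

lemma norm_block_vec_squared: "(norm (block_vec x y))\<^sup>2 = (norm x)\<^sup>2 + (norm y)\<^sup>2"
proof -
  have "(norm (block_vec x y))\<^sup>2 = (\<Sum>i\<in>UNIV <+> UNIV. (block_vec x y $ i)\<^sup>2)"
    by (simp add: norm_vec_def L2_set_def sum_nonneg UNIV_Plus_UNIV)
  also have "\<dots> = (norm x)\<^sup>2 + (norm y)\<^sup>2"
    by (subst sum.Plus) (auto simp: block_vec_def norm_vec_def L2_set_def sum_nonneg)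
  finally show ?thesis .
qed

lemma norm_upper_le: "norm (upper z) \<le> norm z"
proof -
  have "(norm z)\<^sup>2 = (norm (upper z))\<^sup>2 + (norm (lower z))\<^sup>2"
    using norm_block_vec_squared[of "upper z" "lower z"] by simp
  then show ?thesis by (auto intro: power2_le_imp_le)
qed

lemma norm_le_upper_lower: "norm z \<le> norm (upper z) + norm (lower z)"
proof (rule power2_le_imp_le)
  have "(norm z)\<^sup>2 = (norm (upper z))\<^sup>2 + (norm (lower z))\<^sup>2"
    using norm_block_vec_squared[of "upper z" "lower z"] by simp
  then show "(norm z)\<^sup>2 \<le> (norm (upper z) + norm (lower z))\<^sup>2"
    by (simp add: power2_sum)
qed simp

lemma sum_UNIV_Plus: "(\<Sum>i\<in>UNIV. f i) = (\<Sum>a\<in>UNIV. f (Inl a)) + (\<Sum>b\<in>UNIV. f (Inr b))"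
  for f :: "'a::finite + 'b::finite \<Rightarrow> 'c::comm_monoid_add"
  by (simp add: UNIV_Plus_UNIV[symmetric] sum.Plus del: UNIV_Plus_UNIV)

lemma block_mat_mult_vec:
  "block_mat A B C E *v z = block_vec (A *v upper z + B *v lower z) (C *v upper z + E *v lower z)"
  by (simp add: vec_eq_iff block_mat_def block_vec_def matrix_vector_mult_def sum_UNIV_Plus
      upper_def lower_def split: sum.split)

lemma transpose_block_mat:
  "transpose (block_mat A B C E) = block_mat (transpose A) (transpose C) (transpose B) (transpose E)"
  by (simp add: vec_eq_iff block_mat_def transpose_def split: sum.split)

section \<open>The cross-product matrix and the inertia identity\<close>

lemma cross_mat_mult_vec: "cross_mat a *v c = cross3 a c"
  unfolding cross_mat_def
  by (rule matrix_works) (use bilinear_cross in \<open>auto simp: bilinear_def linear_def scalar_mult_eq_scaleR[abs_def]\<close>)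

lemma cross_mat_nth:
  "cross_mat a $ 1 $ 1 = 0" "cross_mat a $ 1 $ 2 = - (a $ 3)" "cross_mat a $ 1 $ 3 = a $ 2"
  "cross_mat a $ 2 $ 1 = a $ 3" "cross_mat a $ 2 $ 2 = 0" "cross_mat a $ 2 $ 3 = - (a $ 1)"
  "cross_mat a $ 3 $ 1 = - (a $ 2)" "cross_mat a $ 3 $ 2 = a $ 1" "cross_mat a $ 3 $ 3 = 0"
  by (simp_all add: cross_mat_def matrix_def cross3_def axis_def)

lemma cross_mat_inject: "cross_mat a = cross_mat b \<longleftrightarrow> a = b"
proof
  assume eq: "cross_mat a = cross_mat b"
  have "cross_mat a $ i $ j = cross_mat b $ i $ j" for i j using eq by simp
  from this[of 3 2] this[of 1 3] this[of 2 1] show "a = b"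
    by (simp add: vec_eq_iff forall_3 cross_mat_nth)
qed simp

lemma vex_cross_mat [simp]: "vex (cross_mat a) = a"
  unfolding vex_def by (rule inv_f_f) (simp add: inj_def cross_mat_inject)

lemma bounded_linear_cross_mat: "bounded_linear cross_mat"
  by (subst linear_conv_bounded_linear[symmetric])
     (auto simp: linear_iff vec_eq_iff forall_3 cross_mat_nth)

text \<open>\<open>vex\<close> is an inverse function with no usable value outside the range of
  \<open>cross_mat\<close>. This linear map is defined everywhere and agrees with \<open>vex\<close>
  on differences \<open>A - transpose A\<close>, which is the shape of the argument in
  \<open>S_Gamma\<close>. It is twice the axial vector of the skew part of \<open>A\<close>.\<close>

definition skew_vec :: "real^3^3 \<Rightarrow> real^3" where
  "skew_vec A = vector [A$3$2 - A$2$3, A$1$3 - A$3$1, A$2$1 - A$1$2]"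

lemma bounded_linear_skew_vec: "bounded_linear skew_vec"
  by (subst linear_conv_bounded_linear[symmetric])
     (auto simp: linear_iff vec_eq_iff forall_3 skew_vec_def algebra_simps)

lemma cross_mat_skew_vec: "cross_mat (skew_vec A) = A - transpose A"
  by (simp add: vec_eq_iff forall_3 cross_mat_nth skew_vec_def transpose_def)

lemma vex_diff_transpose: "vex (A - transpose A) = skew_vec A"
  using vex_cross_mat[of "skew_vec A"] by (simp only: cross_mat_skew_vec)

lemma transpose_cross_mat: "transpose (cross_mat a) = - cross_mat a"
  by (simp add: vec_eq_iff forall_3 cross_mat_nth transpose_def)

text \<open>For symmetric \<open>B\<close> one has
  \<open>a^x B + B a^x = ((trace B I - B) a)^x\<close>. The choice \<open>B = \<J>\<close> has trace
  \<open>trace J / 2\<close>, so the matrix on the right becomes \<open>J\<close>. The equation for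
  \<open>F\<close>, linearized at the identity, is exactly this formula.\<close>

lemma cross_mat_inertia:
  fixes J :: "real^3^3"
  assumes "sym_mat J" defines "\<J> \<equiv> (1/2 * trace J) *\<^sub>R mat 1 - J"
  shows "cross_mat (J *v a) = cross_mat a ** \<J> + \<J> ** cross_mat a"
proof -
  have "transpose J $ i $ j = J $ i $ j" for i j
    using assms(1) by (simp add: sym_mat_def)
  then have "J $ j $ i = J $ i $ j" for i j by (simp add: transpose_def)
  from this[of 2 1] this[of 3 1] this[of 3 2] show ?thesis
    unfolding \<J>_def
    by (simp add: vec_eq_iff forall_3 cross_mat_nth matrix_matrix_mult_def matrix_vector_mult_def
        sum_3 trace_def mat_def algebra_simps)
qed

section \<open>Lower bounds for matrices and norms of inverses\<close>

lemma norm_le_sum_entries: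
  fixes A :: "real^'n^'m"
  shows "norm A \<le> (\<Sum>i\<in>UNIV. \<Sum>j\<in>UNIV. \<bar>A $ i $ j\<bar>)"
proof -
  have "norm A \<le> (\<Sum>i\<in>UNIV. norm (A $ i))"
    unfolding norm_vec_def by (rule L2_set_le_sum) (simp flip: norm_vec_def)
  also have "\<dots> \<le> (\<Sum>i\<in>UNIV. \<Sum>j\<in>UNIV. \<bar>A $ i $ j\<bar>)"
    by (intro sum_mono norm_le_l1_cart)
  finally show ?thesis .
qed

lemma invertible_if_injective:
  fixes A :: "real^'n^'n"
  assumes "\<And>x. A *v x = 0 \<Longrightarrow> x = 0"
  shows "invertible A"
  using assms by (simp add: invertible_left_inverse matrix_left_invertible_ker)

lemma matrix_inv_mult:
  fixes A :: "real^'n^'n"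
  assumes "invertible A"
  shows "A ** matrix_inv A = mat 1" "matrix_inv A ** A = mat 1"
proof -
  have "\<exists>B. A ** B = mat 1 \<and> B ** A = mat 1" using assms by (simp add: invertible_def)
  from someI_ex[OF this] show "A ** matrix_inv A = mat 1" "matrix_inv A ** A = mat 1"
    by (simp_all add: matrix_inv_def)
qed

lemma matrix_inv_mult_vec:
  fixes A :: "real^'n^'n"
  assumes "invertible A"
  shows "A *v (matrix_inv A *v x) = x" "matrix_inv A *v (A *v x) = x"
  by (simp_all add: matrix_vector_mul_assoc matrix_inv_mult[OF assms])

text \<open>\<open>pos_def\<close> does not include symmetry, so the constant is the minimum of the
  quadratic form over the unit sphere instead of an eigenvalue.\<close>

lemma pos_def_coercive:
  fixes A :: "real^'n^'n"
  assumes "pos_def A"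
  obtains c where "0 < c" "\<And>x. c * (norm x)\<^sup>2 \<le> x \<bullet> (A *v x)"
proof -
  let ?f = "\<lambda>x. x \<bullet> (A *v x)"
  have cont: "continuous_on (sphere 0 1) ?f"
    by (intro continuous_on_inner continuous_on_id matrix_vector_mult_linear_continuous_on)
  have "sphere (0::real^'n) 1 \<noteq> {}" by simp
  then obtain u where u: "u \<in> sphere 0 1" "\<And>x. x \<in> sphere 0 1 \<Longrightarrow> ?f u \<le> ?f x"
    using continuous_attains_inf[OF compact_sphere _ cont] by blast
  have "u \<noteq> 0" using u(1) by auto
  then have "0 < ?f u" using assms by (simp add: pos_def_def)
  moreover have "?f u * (norm x)\<^sup>2 \<le> ?f x" for x
  proof (cases "x = 0")
    case False
    then have "?f u \<le> ?f (x /\<^sub>R norm x)" by (intro u) auto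
    also have "\<dots> = ?f x / (norm x)\<^sup>2"
      by (simp add: matrix_vector_mult_scaleR power2_eq_square divide_inverse)
    finally show ?thesis using False by (simp add: field_simps)
  qed simp
  ultimately show ?thesis by (rule that)
qed

lemma coercive_bound:
  fixes A :: "real^'n^'n"
  assumes "0 < c" "\<And>x. c * (norm x)\<^sup>2 \<le> x \<bullet> (A *v x)"
  shows "c * norm x \<le> norm (A *v x)"
proof (cases "x = 0")
  case False
  have "c * norm x * norm x \<le> norm (A *v x) * norm x"
    using order_trans[OF assms(2)[of x] norm_cauchy_schwarz[of x "A *v x"]]
    by (simp add: power2_eq_square ac_simps)
  then show ?thesis using False by (simp add: mult_le_cancel_right)
qed simp

lemma invertible_if_bounded_below:
  fixes A :: "real^'n^'n"
  assumes "0 < m" "\<And>x. m * norm x \<le> norm (A *v x)"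
  shows "invertible A"
proof (rule invertible_if_injective)
  fix x assume "A *v x = 0"
  with assms(2)[of x] have "m * norm x \<le> 0" by simp
  then show "x = 0" using assms(1) by (simp add: mult_le_0_iff)
qed

lemma pos_def_invertible: "pos_def A \<Longrightarrow> invertible A"
  by (erule pos_def_coercive) (blast intro: invertible_if_bounded_below coercive_bound)

text \<open>Column \<open>j\<close> of the inverse is the preimage of a unit vector, so each entry
  is at most \<open>1 / m\<close>. Summing all entries is crude, but it gives what matters: a bound
  depending on \<open>m\<close> and the dimension alone.\<close>

lemma norm_matrix_inv_le:
  fixes A :: "real^'n^'n"
  assumes "0 < m" "\<And>x. m * norm x \<le> norm (A *v x)"
  shows "norm (matrix_inv A) \<le> real CARD('n) * real CARD('n) / m"
proof -
  note inv = matrix_inv_mult_vec[OF invertible_if_bounded_below[OF assms]]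
  have "\<bar>matrix_inv A $ i $ j\<bar> \<le> 1 / m" for i j
  proof -
    have "m * norm (matrix_inv A *v axis j 1) \<le> 1"
      using assms(2)[of "matrix_inv A *v axis j 1"] inv by simp
    then have "norm (matrix_inv A *v axis j 1) \<le> 1 / m" using assms(1) by (simp add: field_simps)
    moreover have "matrix_inv A $ i $ j = (matrix_inv A *v axis j 1) $ i"
      by (simp add: matrix_vector_mul_component inner_axis)
    ultimately show ?thesis
      using component_le_norm_cart[of "matrix_inv A *v axis j 1" i] by simp
  qed
  then have "(\<Sum>i\<in>UNIV. \<Sum>j\<in>UNIV. \<bar>matrix_inv A $ i $ j\<bar>) \<le> (\<Sum>i\<in>(UNIV::'n set). \<Sum>j\<in>(UNIV::'n set). 1 / m)"
    by (intro sum_mono)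
  then show ?thesis using norm_le_sum_entries[of "matrix_inv A"] by simp
qed

text \<open>Resolvent identity \<open>A^-1 - B^-1 = A^-1 (B - A) B^-1\<close>; the common lower
  bound \<open>m\<close> makes both inverses uniformly bounded.\<close>

lemma uclose_matrix_inv:
  fixes f1 f2 :: "'q \<Rightarrow> real^'n^'n"
  assumes "uclose Q r f1 f2" "0 < m"
    and f1: "\<And>q x. q \<in> Q \<Longrightarrow> m * norm x \<le> norm (f1 q *v x)"
    and f2: "\<And>q x. q \<in> Q \<Longrightarrow> m * norm x \<le> norm (f2 q *v x)"
  shows "uclose Q r (\<lambda>q. matrix_inv (f1 q)) (\<lambda>q. matrix_inv (f2 q))"
proof (rule ucloseI)
  show 1: "ubounded Q (\<lambda>q. matrix_inv (f1 q))" and 2: "ubounded Q (\<lambda>q. matrix_inv (f2 q))"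
    using assms norm_matrix_inv_le[OF assms(2) f1] norm_matrix_inv_le[OF assms(2) f2]
    by (auto intro!: ubigoI[where C="real CARD('n) * real CARD('n) / m"])
  have "ubigo Q r (\<lambda>q. matrix_inv (f1 q) ** (f2 q - f1 q) ** matrix_inv (f2 q))"
    using ucloseD(3)[OF uclose_sym[OF assms(1)]]
    by (rule ubigo_bilinear_left[OF bounded_bilinear_matrix_mult
          ubigo_bilinear_right[OF bounded_bilinear_matrix_mult 1] 2])
  then show "ubigo Q r (\<lambda>q. matrix_inv (f1 q) - matrix_inv (f2 q))"
  proof (rule ubigo_cong)
    fix q assume q: "q \<in> Q"
    note inv1 = matrix_inv_mult[OF invertible_if_bounded_below[OF assms(2) f1[OF q]]]
    note inv2 = matrix_inv_mult[OF invertible_if_bounded_below[OF assms(2) f2[OF q]]]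
    interpret mm: bounded_bilinear "(**) :: real^'n^'n \<Rightarrow> real^'n^'n \<Rightarrow> real^'n^'n"
      by (rule bounded_bilinear_matrix_mult)
    show "matrix_inv (f1 q) ** (f2 q - f1 q) ** matrix_inv (f2 q) = matrix_inv (f1 q) - matrix_inv (f2 q)"
      by (simp add: mm.diff_left mm.diff_right inv1 matrix_mul_assoc[symmetric])
         (simp add: matrix_mul_assoc inv1 inv2 mm.diff_left)
  qed
qed

text \<open>With \<open>x = K * norm A\<close>, the tail from the quadratic term on is compared with
  \<open>x^2 exp x\<close>, using \<open>1 / (k + 2)! \<le> 1 / k!\<close>. The bound
  \<open>r\<close> on the norm makes the exponential factor uniform.\<close>

lemma mat_exp_expansion:
  "\<exists>c\<ge>0. \<forall>A::real^'n^'n. norm A \<le> r \<longrightarrow> norm (mat_exp A - mat 1 - A) \<le> c * (norm A)\<^sup>2"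
proof -
  obtain K where K: "0 \<le> K" "\<And>A B. norm ((A::real^'n^'n) ** (B::real^'n^'n)) \<le> norm A * norm B * K"
    using bounded_bilinear.nonneg_bounded[OF bounded_bilinear_matrix_mult] by blast
  let ?n = "norm (mat 1 :: real^'n^'n)"
  have "norm (mat_exp A - mat 1 - A) \<le> (K\<^sup>2 * ?n * exp (K * r)) * (norm A)\<^sup>2" if A: "norm A \<le> r" for A :: "real^'n^'n"
  proof -
    define f where "f k = (1 / fact k) *\<^sub>R (((\<lambda>B. A ** B) ^^ k) (mat 1))" for k
    define x where "x = K * norm A"
    have x: "0 \<le> x" "x \<le> K * r" using K A mult_left_mono[of "norm A" r K] by (auto simp: x_def)
    have pow: "norm (((\<lambda>B. A ** B) ^^ k) (mat 1)) \<le> x ^ k * ?n" for k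
    proof (induction k)
      case (Suc k)
      have "norm (((\<lambda>B. A ** B) ^^ Suc k) (mat 1)) \<le> norm A * norm (((\<lambda>B. A ** B) ^^ k) (mat 1)) * K"
        using K(2) by simp
      also have "\<dots> \<le> norm A * (x ^ k * ?n) * K"
        using Suc K by (intro mult_right_mono mult_left_mono) auto
      finally show ?case by (simp add: x_def algebra_simps)
    qed simp
    have norm_f: "norm (f k) \<le> inverse (fact k) * x ^ k * ?n" for k
      using mult_left_mono[OF pow[of k], of "inverse (fact k)"] by (simp add: f_def divide_inverse algebra_simps)
    have sum_f: "summable f"
      by (rule summable_comparison_test'[OF summable_mult2[OF summable_exp[of x]]]) (rule norm_f)
    have "mat_exp A = (\<Sum>k. f (k + 2)) + (f 0 + f 1)"
      using suminf_split_initial_segment[OF sum_f, of 2]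
      by (simp add: mat_exp_def f_def[abs_def] numeral_2_eq_2)
    moreover have "f 0 = mat 1" "f 1 = A" by (simp_all add: f_def)
    ultimately have "mat_exp A - mat 1 - A = (\<Sum>k. f (k + 2))" by simp
    also have "norm \<dots> \<le> (\<Sum>k. (inverse (fact k) * x ^ k) * (x\<^sup>2 * ?n))"
    proof (rule norm_suminf_le)
      show "summable (\<lambda>k. (inverse (fact k) * x ^ k) * (x\<^sup>2 * ?n))"
        by (intro summable_mult2 summable_exp)
      fix k
      have "inverse (fact (k + 2)) \<le> (inverse (fact k) :: real)"
        by (intro le_imp_inverse_le fact_mono) auto
      then have "inverse (fact (k + 2)) * (x ^ (k + 2) * ?n) \<le> inverse (fact k) * (x ^ (k + 2) * ?n)"
        using x by (intro mult_right_mono) auto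
      with norm_f[of "k + 2"] have "norm (f (k + 2)) \<le> inverse (fact k) * (x ^ (k + 2) * ?n)"
        by (simp only: mult.assoc)
      then show "norm (f (k + 2)) \<le> (inverse (fact k) * x ^ k) * (x\<^sup>2 * ?n)"
        by (simp only: power_add mult.assoc)
    qed
    also have "\<dots> = exp x * (x\<^sup>2 * ?n)"
      by (subst suminf_mult2[symmetric, OF summable_exp]) (simp add: exp_def divide_inverse)
    also have "\<dots> \<le> exp (K * r) * (x\<^sup>2 * ?n)" using x by (intro mult_right_mono) auto
    finally show ?thesis by (simp add: x_def power_mult_distrib algebra_simps)
  qed
  then show ?thesis using K by (intro exI[of _ "K\<^sup>2 * ?n * exp (K * r)"]) auto
qed

text \<open>The last row of a pose forces the last entry of \<open>x\<close> to vanish, and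
  orthogonality of the rotation disposes of the rest. Compactness later turns this pointwise fact
  along the exact solution into a uniform lower bound.\<close>

lemma SE3_injective:
  assumes "g \<in> SE3" "g *v x = 0"
  shows "x = 0"
proof -
  obtain R b where g: "g = pose_of R b" and R: "rotation_matrix R"
    using assms(1) by (auto simp: SE3_def)
  have zero: "(0 :: real^(3+1)) = block_vec 0 0" by (simp add: block_vec_def vec_eq_iff split: sum.split)
  have "block_vec (R *v upper x + columnvector b *v lower x) (lower x) = block_vec 0 0"
    using assms(2) by (simp add: g pose_of_def block_mat_mult_vec zero del: block_vec_eq_iff)
  then have "R *v upper x + columnvector b *v lower x = 0" and "lower x = 0"
    unfolding block_vec_eq_iff by blast+
  then have "R *v upper x = 0" by simp
  then have "(transpose R ** R) *v upper x = 0"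
    by (simp only: matrix_vector_mul_assoc[symmetric]) simp
  then have "upper x = 0" using R by (simp add: rotation_matrix_def orthogonal_matrix)
  with \<open>lower x = 0\<close> show ?thesis by (metis block_vec_upper_lower zero)
qed

section \<open>The attitude increment\<close>

text \<open>Split \<open>A = F - I\<close> into its symmetric part \<open>E\<close> and its skew
  part \<open>f^x\<close>. Orthogonality gives \<open>A + A^T = - A A^T\<close>, so \<open>E\<close>
  is quadratic in \<open>A\<close>. In the equation for \<open>F\<close> the skew part contributes
  \<open>(J f)^x\<close> and \<open>E\<close> enters linearly, so \<open>f - h \<omega>\<close> is
  bounded by a multiple of \<open>norm E\<close>. The estimate holds for every solution, but it says
  something only when \<open>norm A\<close> is small.\<close>

lemma attitude_increment_quadratic:
  fixes J :: "real^3^3"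
  assumes J: "sym_mat J" "pos_def J"
  defines "\<J> \<equiv> (1/2 * trace J) *\<^sub>R mat 1 - J"
  shows "\<exists>C>0. \<forall>h \<omega> F. 0 < h \<and> rotation_matrix F \<and>
      cross_mat (J *v \<omega>) = (1 / h) *\<^sub>R (F ** \<J> - \<J> ** transpose F) \<longrightarrow>
      norm (F - mat 1 - h *\<^sub>R cross_mat \<omega>) \<le> C * (norm (F - mat 1))\<^sup>2"
proof -
  interpret mm: bounded_bilinear "(**) :: real^3^3 \<Rightarrow> real^3^3 \<Rightarrow> real^3^3"
    by (rule bounded_bilinear_matrix_mult)
  interpret tr: bounded_linear "transpose :: real^3^3 \<Rightarrow> real^3^3" by (rule bounded_linear_transpose)
  interpret cm: bounded_linear cross_mat by (rule bounded_linear_cross_mat)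
  interpret sv: bounded_linear skew_vec by (rule bounded_linear_skew_vec)
  obtain K where K: "0 \<le> K" "\<And>A B. norm ((A::real^3^3) ** (B::real^3^3)) \<le> norm A * norm B * K"
    using mm.nonneg_bounded by blast
  obtain Kt where Kt: "0 \<le> Kt" "\<And>A. norm (transpose A :: real^3^3) \<le> norm A * Kt"
    using tr.nonneg_bounded by blast
  obtain Kc where Kc: "0 \<le> Kc" "\<And>a. norm (cross_mat a) \<le> norm a * Kc" using cm.nonneg_bounded by blast
  obtain Ks where Ks: "0 \<le> Ks" "\<And>A. norm (skew_vec A) \<le> norm A * Ks" using sv.nonneg_bounded by blast
  obtain c where c: "0 < c" "\<And>x. c * norm x \<le> norm (J *v x)"
    using pos_def_coercive[OF J(2)] coercive_bound by metis
  define k2 where "k2 = norm \<J> * K * Ks / c"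
  have k2: "0 \<le> k2" using K Ks c by (simp add: k2_def)
  \<comment> \<open>The 1 makes \<open>C\<close> positive: its reciprocal later determines the
    radius \<open>\<epsilon>0\<close>.\<close>
  define C where "C = (1 + Kc * k2) * (K * Kt) + 1"
  have sym: "transpose \<J> = \<J>" using J(1) by (simp add: \<J>_def tr.diff transpose_scalar sym_mat_def)
  have "norm (F - mat 1 - h *\<^sub>R cross_mat \<omega>) \<le> C * (norm (F - mat 1))\<^sup>2"
    if h: "0 < h" and F: "rotation_matrix F"
      and eq: "cross_mat (J *v \<omega>) = (1 / h) *\<^sub>R (F ** \<J> - \<J> ** transpose F)" for h \<omega> F
  proof -
    define A where "A = F - mat 1"
    define E where "E = (1/2) *\<^sub>R (A + transpose A)"
    define f where "f = (1/2) *\<^sub>R skew_vec A"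
    have FA: "F = A + mat 1" by (simp add: A_def)
    have "F ** transpose F = mat 1" using F by (simp add: rotation_matrix_def orthogonal_matrix_def)
    then have "A ** transpose A + (A + transpose A) = 0" by (simp add: FA tr.add mm.add_left mm.add_right ac_simps)
    then have AAT: "A + transpose A = - (A ** transpose A)" by (simp add: add_eq_0_iff)
    have "norm (A ** transpose A) \<le> norm A * norm (transpose A) * K" by (rule K)
    also have "\<dots> \<le> norm A * (norm A * Kt) * K"
      using Kt K by (intro mult_right_mono mult_left_mono) auto
    finally have "norm (A ** transpose A) \<le> K * Kt * (norm A)\<^sup>2"
      by (simp add: power2_eq_square algebra_simps)
    moreover have "norm E \<le> norm (A ** transpose A)" by (simp add: E_def AAT)
    ultimately have E: "norm E \<le> K * Kt * (norm A)\<^sup>2" by (rule order_trans[rotated])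
    have A: "A = E + cross_mat f"
      by (simp add: E_def f_def cm.scaleR cross_mat_skew_vec algebra_simps flip: scaleR_left_distrib)
    have symE: "transpose E = E" by (simp add: E_def transpose_scalar tr.add add.commute)
    then have AT: "transpose A = E - cross_mat f" by (subst A) (simp add: tr.add transpose_cross_mat)
    have "h *\<^sub>R cross_mat (J *v \<omega>) = A ** \<J> - \<J> ** transpose A"
      using h by (simp add: eq FA tr.add mm.add_left mm.add_right)
    also have "\<dots> = (E ** \<J> - \<J> ** E) + (cross_mat f ** \<J> + \<J> ** cross_mat f)"
      by (simp add: AT mm.diff_right) (simp add: A mm.add_left)
    \<comment> \<open>\<open>E ** \<J>\<close> minus its transpose is skew, hence the cross-product
      matrix of a vector linear in \<open>E\<close>. The whole equation thus becomes an equation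
      between vectors.\<close>
    also have "\<dots> = (E ** \<J> - transpose (E ** \<J>)) + cross_mat (J *v f)"
      using cross_mat_inertia[OF J(1), of f, folded \<J>_def] by (simp add: matrix_transpose_mul sym symE)
    finally have "cross_mat (J *v (h *\<^sub>R \<omega> - f)) = cross_mat (skew_vec (E ** \<J>))"
      by (simp add: cross_mat_skew_vec cm.diff cm.scaleR matrix_vector_mult_diff_distrib
          matrix_vector_mult_scaleR algebra_simps)
    then have "J *v (h *\<^sub>R \<omega> - f) = skew_vec (E ** \<J>)" by (simp only: cross_mat_inject)
    then have "c * norm (h *\<^sub>R \<omega> - f) \<le> norm (E ** \<J>) * Ks"
      using c(2)[of "h *\<^sub>R \<omega> - f"] Ks(2)[of "E ** \<J>"] by simp
    also have "\<dots> \<le> (norm E * norm \<J> * K) * Ks" by (intro mult_right_mono K Ks)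
    finally have f: "norm (f - h *\<^sub>R \<omega>) \<le> k2 * norm E"
      using c by (simp add: k2_def field_simps norm_minus_commute)
    have "norm (A - h *\<^sub>R cross_mat \<omega>) = norm (E + cross_mat (f - h *\<^sub>R \<omega>))"
      by (subst A) (simp add: cm.diff cm.scaleR algebra_simps)
    also have "\<dots> \<le> norm E + norm (f - h *\<^sub>R \<omega>) * Kc"
      using norm_triangle_ineq Kc(2) by (metis add_left_mono order_trans)
    also have "\<dots> \<le> norm E + (k2 * norm E) * Kc"
      using f Kc by (intro add_left_mono mult_right_mono)
    also have "\<dots> = (1 + Kc * k2) * norm E" by (simp add: algebra_simps)
    also have "\<dots> \<le> (1 + Kc * k2) * (K * Kt * (norm A)\<^sup>2)"
      using E Kc k2 by (intro mult_left_mono) auto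
    also have "\<dots> \<le> C * (norm A)\<^sup>2" by (simp add: C_def algebra_simps)
    finally show ?thesis by (simp add: A_def)
  qed
  moreover have "0 < C" using Kc k2 K Kt by (simp add: C_def add_nonneg_pos)
  ultimately show ?thesis by blast
qed

lemma norm_mat_exp_cross_diff_le:
  obtains Kc c where "0 < Kc" "0 \<le> c" "\<And>a. norm (cross_mat a) \<le> Kc * norm a"
    "\<And>h \<omega> \<rho>. 0 < h \<Longrightarrow> norm \<omega> \<le> \<rho> \<Longrightarrow> Kc * \<rho> * h \<le> 1 \<Longrightarrow>
      norm (mat_exp (h *\<^sub>R cross_mat \<omega>) - mat 1) \<le> c * (Kc * \<rho> * h)"
    "\<And>h \<omega> \<rho>. 0 < h \<Longrightarrow> norm \<omega> \<le> \<rho> \<Longrightarrow> norm (h *\<^sub>R cross_mat \<omega>) \<le> Kc * \<rho> * h"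
proof -
  obtain Kc where Kc: "0 < Kc" "\<And>a. norm (cross_mat a) \<le> norm a * Kc"
    using bounded_linear.pos_bounded[OF bounded_linear_cross_mat] by blast
  obtain c where c: "c \<ge> 0" "\<And>A::real^3^3. norm A \<le> 1 \<Longrightarrow> norm (mat_exp A - mat 1 - A) \<le> c * (norm A)\<^sup>2"
    using mat_exp_expansion[of 1] by blast
  have le: "norm (h *\<^sub>R cross_mat \<omega>) \<le> Kc * \<rho> * h" if "0 < h" "norm \<omega> \<le> \<rho>" for h \<omega> \<rho>
  proof -
    have "norm (cross_mat \<omega>) \<le> Kc * \<rho>"
      using order_trans[OF Kc(2)[of \<omega>] mult_right_mono[OF that(2), of Kc]] Kc(1) by (simp add: mult.commute)
    then show ?thesis using that mult_left_mono[of _ _ h] by (simp add: mult.commute)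
  qed
  have "norm (mat_exp (h *\<^sub>R cross_mat \<omega>) - mat 1) \<le> (c + 1) * (Kc * \<rho> * h)"
    if "0 < h" "norm \<omega> \<le> \<rho>" "Kc * \<rho> * h \<le> 1" for h \<omega> \<rho>
  proof -
    define A where "A = h *\<^sub>R cross_mat \<omega>"
    have A: "norm A \<le> Kc * \<rho> * h" "norm A \<le> 1" using le that unfolding A_def by (blast intro: order_trans)+
    have "(norm A)\<^sup>2 \<le> norm A" using A(2) by (simp add: power2_eq_square mult_left_le)
    then have "norm (mat_exp A - mat 1 - A) \<le> c * norm A"
      using c(2)[OF A(2)] c(1) by (meson mult_left_mono order_trans)
    then have "norm (mat_exp A - mat 1) \<le> (c + 1) * norm A"
      using norm_triangle_sub[of "mat_exp A - mat 1" A] by (simp add: algebra_simps)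
    also have "\<dots> \<le> (c + 1) * (Kc * \<rho> * h)" using A c(1) by (intro mult_left_mono) auto
    finally show ?thesis by (simp add: A_def)
  qed
  with that[of Kc "c+1"] Kc c(1) le show ?thesis by (auto simp: mult.commute)
qed

text \<open>Absorption: for small \<open>F - I\<close> the quadratic bound yields
  \<open>norm (F - I) \<le> O(h) + norm (F - I) / 2\<close>, so \<open>F - I\<close> is O(h) and the
  quadratic error is O(h^2). The order of the quantifiers matters: the radius
  \<open>\<epsilon>0\<close> depends on \<open>J\<close> alone, while the step-size bound and the
  constant may depend on \<open>\<rho>\<close>.\<close>

lemma attitude_increment_expansion:
  fixes J :: "real^3^3"
  assumes J: "sym_mat J" "pos_def J"
  defines "\<J> \<equiv> (1/2 * trace J) *\<^sub>R mat 1 - J"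
  shows "\<exists>\<epsilon>0>0. \<forall>\<rho>\<ge>0. \<exists>h1>0. \<exists>C\<ge>0. \<forall>h \<omega> F. 0 < h \<and> h \<le> h1 \<and> norm \<omega> \<le> \<rho> \<and>
      rotation_matrix F \<and> norm (F - mat_exp (h *\<^sub>R cross_mat \<omega>)) < \<epsilon>0 \<and>
      cross_mat (J *v \<omega>) = (1 / h) *\<^sub>R (F ** \<J> - \<J> ** transpose F) \<longrightarrow>
      norm (F - mat 1 - h *\<^sub>R cross_mat \<omega>) \<le> C * h\<^sup>2"
proof -
  obtain C1 where C1: "0 < C1" "\<And>h \<omega> F. 0 < h \<Longrightarrow> rotation_matrix F \<Longrightarrow>
      cross_mat (J *v \<omega>) = (1 / h) *\<^sub>R (F ** \<J> - \<J> ** transpose F) \<Longrightarrow>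
      norm (F - mat 1 - h *\<^sub>R cross_mat \<omega>) \<le> C1 * (norm (F - mat 1))\<^sup>2"
    using attitude_increment_quadratic[OF J, folded \<J>_def] by blast
  obtain Kc c where Kc: "0 < Kc" "0 \<le> c"
    "\<And>h \<omega> \<rho>. 0 < h \<Longrightarrow> norm \<omega> \<le> \<rho> \<Longrightarrow> Kc * \<rho> * h \<le> 1 \<Longrightarrow>
      norm (mat_exp (h *\<^sub>R cross_mat \<omega>) - mat 1) \<le> c * (Kc * \<rho> * h)"
    "\<And>h \<omega> \<rho>. 0 < h \<Longrightarrow> norm \<omega> \<le> \<rho> \<Longrightarrow> norm (h *\<^sub>R cross_mat \<omega>) \<le> Kc * \<rho> * h"
    using norm_mat_exp_cross_diff_le by metis
  have "\<exists>h1>0. \<exists>C\<ge>0. \<forall>h \<omega> F. 0 < h \<and> h \<le> h1 \<and> norm \<omega> \<le> \<rho> \<and>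
      rotation_matrix F \<and> norm (F - mat_exp (h *\<^sub>R cross_mat \<omega>)) < 1 / (4 * C1) \<and>
      cross_mat (J *v \<omega>) = (1 / h) *\<^sub>R (F ** \<J> - \<J> ** transpose F) \<longrightarrow>
      norm (F - mat 1 - h *\<^sub>R cross_mat \<omega>) \<le> C * h\<^sup>2" if \<rho>: "0 \<le> \<rho>" for \<rho>
  proof -
    \<comment> \<open>Absorption requires \<open>norm (F - I) \<le> 1 / (2 * C1)\<close>. One half
      of this is granted by the neighbourhood of the exponential. The other half is the distance of
      the exponential from the identity, which is small enough once
      \<open>Kc * \<rho> * h \<le> s\<close>.\<close>
    define s where "s = min 1 (1 / (4 * C1 * (c + 1)))"
    have s: "0 < s" "s \<le> 1" using C1 Kc by (auto simp: s_def)
    have cs: "c * s \<le> 1 / (4 * C1)"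
    proof -
      have "s \<le> 1 / (4 * C1 * (c + 1))" by (simp add: s_def)
      then have "(c + 1) * s \<le> (c + 1) * (1 / (4 * C1 * (c + 1)))" using Kc(2) by (intro mult_left_mono) auto
      also have "\<dots> = 1 / (4 * C1)" using Kc(2) by simp
      finally have "(c + 1) * s \<le> 1 / (4 * C1)" .
      then show ?thesis using s by (simp add: algebra_simps)
    qed
    define h1 where "h1 = s / (Kc * (\<rho> + 1))"
    have h1: "0 < h1" using s Kc \<rho> by (simp add: h1_def)
    have "norm (F - mat 1 - h *\<^sub>R cross_mat \<omega>) \<le> (C1 * (2 * Kc * \<rho>)\<^sup>2) * h\<^sup>2"
      if h: "0 < h" "h \<le> h1" and \<omega>: "norm \<omega> \<le> \<rho>" and F: "rotation_matrix F"
        and near: "norm (F - mat_exp (h *\<^sub>R cross_mat \<omega>)) < 1 / (4 * C1)"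
        and eq: "cross_mat (J *v \<omega>) = (1 / h) *\<^sub>R (F ** \<J> - \<J> ** transpose F)" for h \<omega> F
    proof -
      define a where "a = norm (F - mat 1)"
      have "0 < Kc * (\<rho> + 1)" using Kc(1) \<rho> by simp
      then have "Kc * (\<rho> + 1) * h \<le> s"
        using h(2) unfolding h1_def by (simp only: pos_le_divide_eq mult.commute)
      then have hs: "Kc * \<rho> * h \<le> s" using h Kc by (simp add: algebra_simps) (smt (verit) mult_pos_pos)
      then have "norm (mat_exp (h *\<^sub>R cross_mat \<omega>) - mat 1) \<le> c * (Kc * \<rho> * h)"
        using s by (intro Kc h \<omega>) auto
      also have "\<dots> \<le> c * s" using hs Kc by (intro mult_left_mono) auto
      finally have "norm (mat_exp (h *\<^sub>R cross_mat \<omega>) - mat 1) \<le> 1 / (4 * C1)" using cs by simp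
      moreover have "a \<le> norm (F - mat_exp (h *\<^sub>R cross_mat \<omega>)) + norm (mat_exp (h *\<^sub>R cross_mat \<omega>) - mat 1)"
        unfolding a_def using norm_triangle_ineq[of "F - mat_exp (h *\<^sub>R cross_mat \<omega>)"
            "mat_exp (h *\<^sub>R cross_mat \<omega>) - mat 1"] by simp
      ultimately have "a \<le> 1 / (4 * C1) + 1 / (4 * C1)" using near by linarith
      then have "C1 * a \<le> 1 / 2" using C1 by (simp add: field_simps)
      then have small: "C1 * a\<^sup>2 \<le> a / 2"
        using mult_right_mono[of "C1 * a" "1/2" a] by (simp add: a_def power2_eq_square mult.assoc)
      have est: "norm (F - mat 1 - h *\<^sub>R cross_mat \<omega>) \<le> C1 * a\<^sup>2"
        unfolding a_def by (intro C1 h F eq)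
      have "a \<le> norm (h *\<^sub>R cross_mat \<omega>) + norm (F - mat 1 - h *\<^sub>R cross_mat \<omega>)"
        unfolding a_def by (rule norm_triangle_sub)
      also have "\<dots> \<le> Kc * \<rho> * h + a / 2" using est small Kc(4)[OF h(1) \<omega>] by linarith
      finally have "a \<le> 2 * Kc * \<rho> * h" by simp
      then have "a\<^sup>2 \<le> (2 * Kc * \<rho> * h)\<^sup>2" by (intro power_mono) (auto simp: a_def)
      then have "C1 * a\<^sup>2 \<le> C1 * (2 * Kc * \<rho> * h)\<^sup>2" using C1 by simp
      then show ?thesis using est by (simp add: power_mult_distrib mult.assoc)
    qed
    then show ?thesis using h1 C1 by (intro exI[of _ h1] conjI exI[of _ "C1 * (2 * Kc * \<rho>)\<^sup>2"]) auto
  qed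
  then show ?thesis using C1 by (intro exI[of _ "1 / (4 * C1)"]) auto
qed

text \<open>This is \<open>(I + a^x) (I - a^x)^-1\<close> in closed form, by
  \<open>(a^x)^3 = - (a . a) a^x\<close>; the vector \<open>a\<close> is
  \<open>tan (theta / 2)\<close> times the unit axis. Without an inverse in the formula,
  orthogonality and the determinant become polynomial identities in the components of
  \<open>a\<close>.\<close>

definition cayley :: "real^3 \<Rightarrow> real^3^3" where
  "cayley a = mat 1 + (2 / (1 + a \<bullet> a)) *\<^sub>R (cross_mat a + cross_mat a ** cross_mat a)"

lemma one_plus_inner_pos: "0 < 1 + a \<bullet> (a::real^3)"
  by (simp add: add_pos_nonneg)

lemma rotation_matrix_cayley: "rotation_matrix (cayley a)"
proof -
  define d where "d = 1 + a \<bullet> a"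
  have d: "d \<noteq> 0" using one_plus_inner_pos[of a] by (simp add: d_def)
  define N where "N = d *\<^sub>R mat 1 + 2 *\<^sub>R (cross_mat a + cross_mat a ** cross_mat a)"
  have cay: "cayley a = (1 / d) *\<^sub>R N"
    using d by (simp add: cayley_def N_def d_def[symmetric] scaleR_add_right)
  have dd: "d = 1 + a$1 * a$1 + a$2 * a$2 + a$3 * a$3" by (simp add: d_def inner_vec_def sum_3)
  have N: "N$1$1 = 1 + a$1*a$1 - a$2*a$2 - a$3*a$3" "N$1$2 = 2*a$1*a$2 - 2*a$3" "N$1$3 = 2*a$1*a$3 + 2*a$2"
     "N$2$1 = 2*a$1*a$2 + 2*a$3" "N$2$2 = 1 - a$1*a$1 + a$2*a$2 - a$3*a$3" "N$2$3 = 2*a$2*a$3 - 2*a$1"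
     "N$3$1 = 2*a$1*a$3 - 2*a$2" "N$3$2 = 2*a$2*a$3 + 2*a$1" "N$3$3 = 1 - a$1*a$1 - a$2*a$2 + a$3*a$3"
    by (simp_all add: N_def dd cross_mat_nth matrix_matrix_mult_def sum_3 mat_def algebra_simps)
  have "transpose N ** N = (d * d) *\<^sub>R mat 1"
    by (simp add: vec_eq_iff forall_3 matrix_matrix_mult_def transpose_def sum_3 mat_def N dd algebra_simps)
  then have "transpose (cayley a) ** cayley a = mat 1"
    using d unfolding cay
    by (simp add: transpose_scalar bounded_bilinear.scaleR_left[OF bounded_bilinear_matrix_mult]
        bounded_bilinear.scaleR_right[OF bounded_bilinear_matrix_mult])
  moreover have "det N = d * d * d" by (simp add: det_3 N dd algebra_simps)
  then have "det (cayley a) = 1" using d unfolding cay det_3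
    by (simp add: field_simps)
  ultimately show ?thesis by (simp add: rotation_matrix_def orthogonal_matrix)
qed

text \<open>In these coordinates the equation for \<open>F\<close> reads
  \<open>J a + a \<times> J a = (1 + a . a) / 2 * h * J \<omega>\<close>. The linear part of
  \<open>cayley\<close> yields \<open>J a\<close> by the inertia identity, the quadratic part yields
  the cross product.\<close>

lemma cayley_inertia:
  fixes J :: "real^3^3"
  assumes "sym_mat J" defines "\<J> \<equiv> (1/2 * trace J) *\<^sub>R mat 1 - J"
  shows "cayley a ** \<J> - \<J> ** transpose (cayley a) =
    (2 / (1 + a \<bullet> a)) *\<^sub>R cross_mat (J *v a + cross3 a (J *v a))"
proof -
  interpret mm: bounded_bilinear "(**) :: real^3^3 \<Rightarrow> real^3^3 \<Rightarrow> real^3^3"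
    by (rule bounded_bilinear_matrix_mult)
  interpret tr: bounded_linear "transpose :: real^3^3 \<Rightarrow> real^3^3" by (rule bounded_linear_transpose)
  let ?X = "cross_mat a"
  have "transpose J $ i $ j = J $ i $ j" for i j
    using assms(1) by (simp add: sym_mat_def)
  then have "J $ j $ i = J $ i $ j" for i j by (simp add: transpose_def)
  from this[of 2 1] this[of 3 1] this[of 3 2]
  have "(?X ** ?X) ** \<J> - \<J> ** (?X ** ?X) = cross_mat (cross3 a (J *v a))"
    unfolding \<J>_def
    by (simp add: vec_eq_iff forall_3 cross_mat_nth matrix_matrix_mult_def matrix_vector_mult_def
        cross_components sum_3 trace_def mat_def algebra_simps)
  moreover have "cross_mat (J *v a + cross3 a (J *v a)) =
      (?X ** \<J> + \<J> ** ?X) + cross_mat (cross3 a (J *v a))"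
    using cross_mat_inertia[OF assms(1), of a, folded \<J>_def]
    by (simp add: bounded_linear.linear[OF bounded_linear_cross_mat] linear_add)
  moreover have "cayley a ** \<J> - \<J> ** transpose (cayley a) =
     (2 / (1 + a \<bullet> a)) *\<^sub>R ((?X ** \<J> + \<J> ** ?X) + ((?X ** ?X) ** \<J> - \<J> ** (?X ** ?X)))"
    unfolding cayley_def
    by (simp add: tr.add transpose_scalar transpose_cross_mat matrix_transpose_mul mm.minus_left mm.minus_right
        mm.add_left mm.add_right mm.scaleR_left mm.scaleR_right mm.diff_left mm.diff_right algebra_simps)
  ultimately show ?thesis by simp
qed

text \<open>Solving the vector equation for its linear term exhibits \<open>a\<close> as a fixed
  point of \<open>T\<close>, a continuous self-map of a ball of radius O(h). The resulting rotation
  and the exponential are both O(h)-close to the identity, hence within \<open>\<epsilon>\<close> of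
  each other for small \<open>h\<close>.\<close>

lemma attitude_increment_exists:
  fixes J :: "real^3^3"
  assumes J: "sym_mat J" "pos_def J" and "0 < \<epsilon>" "0 \<le> \<rho>"
  defines "\<J> \<equiv> (1/2 * trace J) *\<^sub>R mat 1 - J"
  shows "\<exists>h1>0. \<forall>h \<omega>. 0 < h \<and> h \<le> h1 \<and> norm \<omega> \<le> \<rho> \<longrightarrow>
    (\<exists>F. rotation_matrix F \<and> norm (F - mat_exp (h *\<^sub>R cross_mat \<omega>)) < \<epsilon> \<and>
       cross_mat (J *v \<omega>) = (1 / h) *\<^sub>R (F ** \<J> - \<J> ** transpose F))"
proof -
  interpret cm: bounded_linear cross_mat by (rule bounded_linear_cross_mat)
  obtain Kc c where Kc: "0 < Kc" "0 \<le> c" "\<And>a. norm (cross_mat a) \<le> Kc * norm a"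
    "\<And>h \<omega> \<rho>. 0 < h \<Longrightarrow> norm \<omega> \<le> \<rho> \<Longrightarrow> Kc * \<rho> * h \<le> 1 \<Longrightarrow>
      norm (mat_exp (h *\<^sub>R cross_mat \<omega>) - mat 1) \<le> c * (Kc * \<rho> * h)"
    using norm_mat_exp_cross_diff_le by metis
  obtain K where K: "0 < K" "\<And>A B. norm ((A::real^3^3) ** (B::real^3^3)) \<le> norm A * norm B * K"
    using bounded_bilinear.pos_bounded[OF bounded_bilinear_matrix_mult] by blast
  note inv = matrix_inv_mult_vec[OF pos_def_invertible[OF J(2)]]
  define q where "q a b = matrix_inv J *v (cross3 a (J *v b))" for a b
  have "bounded_bilinear q"
    by (subst bilinear_conv_bounded_bilinear[symmetric])
       (auto simp: bilinear_def linear_iff q_def cross_add_left cross_add_right cross_mult_left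
         cross_mult_right matrix_vector_right_distrib matrix_vector_mult_scaleR)
  then obtain k where k: "0 < k" "\<And>a b. norm (q a b) \<le> norm a * norm b * k"
    using bounded_bilinear.pos_bounded by blast
  \<comment> \<open>Twice the bound \<open>h * (\<rho> + 1)\<close> on the leading term, so that
    half of the radius is left for the quadratic term \<open>q a a\<close>.\<close>
  define r where "r h = 2 * h * (\<rho> + 1)" for h
  \<comment> \<open>\<open>M * h\<close> bounds the sum of the distances of the Cayley rotation and
    of the exponential from the identity.\<close>
  define M where "M = 2 * (Kc + Kc * Kc * K) * (2 * (\<rho> + 1)) + c * Kc * (\<rho> + 1)"
  have "0 < Kc + Kc * Kc * K" using Kc(1) K(1) by (simp add: add_pos_pos)
  then have "0 < 2 * (Kc + Kc * Kc * K) * (2 * (\<rho> + 1))" using \<open>0 \<le> \<rho>\<close> by (intro mult_pos_pos) auto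
  moreover have "0 \<le> c * Kc * (\<rho> + 1)" using Kc(1,2) \<open>0 \<le> \<rho>\<close> by simp
  ultimately have M: "0 < M" by (simp add: M_def)
  \<comment> \<open>The four bounds give, in this order, \<open>s \<le> 1\<close>,
    \<open>s * k \<le> 1/2\<close>, an exponent of norm at most 1, and
    \<open>M * h \<le> \<epsilon> / 2\<close>.\<close>
  define h1 where "h1 = min (1 / (2 * (\<rho> + 1))) (min (1 / (4 * k * (\<rho> + 1)))
     (min (1 / (Kc * (\<rho> + 1))) (\<epsilon> / (2 * M))))"
  have "0 < h1" using \<open>0 \<le> \<rho>\<close> \<open>0 < \<epsilon>\<close> k Kc M by (simp add: h1_def)
  moreover have "\<exists>F. rotation_matrix F \<and> norm (F - mat_exp (h *\<^sub>R cross_mat \<omega>)) < \<epsilon> \<and>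
       cross_mat (J *v \<omega>) = (1 / h) *\<^sub>R (F ** \<J> - \<J> ** transpose F)"
    if h: "0 < h" "h \<le> h1" and \<omega>: "norm \<omega> \<le> \<rho>" for h \<omega>
  proof -
    define s where "s = r h"
    have s: "0 < s" using h \<open>0 \<le> \<rho>\<close> by (simp add: s_def r_def)
    have le: "h \<le> 1 / (2 * (\<rho> + 1))" "h \<le> 1 / (4 * k * (\<rho> + 1))" "h \<le> 1 / (Kc * (\<rho> + 1))" "h \<le> \<epsilon> / (2 * M)"
      using h by (auto simp: h1_def)
    have s1: "s \<le> 1" using le(1) \<open>0 \<le> \<rho>\<close> by (simp add: s_def r_def field_simps)
    have "0 < 4 * k * (\<rho> + 1)" using k(1) \<open>0 \<le> \<rho>\<close> by simp
    then have "h * (4 * k * (\<rho> + 1)) \<le> 1" using le(2) by (simp only: pos_le_divide_eq)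
    then have ks: "s * k \<le> 1/2" by (simp add: s_def r_def algebra_simps)
    have "0 < Kc * (\<rho> + 1)" using Kc(1) \<open>0 \<le> \<rho>\<close> by simp
    then have Kh: "Kc * (\<rho> + 1) * h \<le> 1" using le(3) by (simp only: pos_le_divide_eq mult.commute)
    have Mh: "M * h < \<epsilon>"
    proof -
      have "M * h \<le> \<epsilon> / 2" using le(4) M by (simp add: field_simps)
      then show ?thesis using \<open>0 < \<epsilon>\<close> by simp
    qed
    define T where "T a = ((1 + a \<bullet> a) / 2 * h) *\<^sub>R \<omega> - q a a" for a
    have "T a \<in> cball 0 s" if "a \<in> cball 0 s" for a
    proof -
      have a: "norm a \<le> s" using that by simp
      have "a \<bullet> a = norm a * norm a" by (simp add: dot_square_norm power2_eq_square)
      also have "\<dots> \<le> 1 * 1" using a s1 by (intro mult_mono) auto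
      finally have "(1 + a \<bullet> a) / 2 * h \<le> 1 * h" using h by (intro mult_right_mono) auto
      moreover have "norm (((1 + a \<bullet> a) / 2 * h) *\<^sub>R \<omega>) = ((1 + a \<bullet> a) / 2 * h) * norm \<omega>"
        using h one_plus_inner_pos[of a] by simp
      ultimately have "norm (((1 + a \<bullet> a) / 2 * h) *\<^sub>R \<omega>) \<le> h * (\<rho> + 1)"
        using h \<omega> mult_mono[of "(1 + a \<bullet> a) / 2 * h" h "norm \<omega>" "\<rho> + 1"] by simp
      moreover have "norm a * norm a * k \<le> s * s * k" using a s k by (intro mult_right_mono mult_mono) auto
      then have "norm (q a a) \<le> s * (s * k)" using k(2)[of a a] by simp
      then have "norm (q a a) \<le> s * (1/2)" using ks s mult_left_mono[of "s*k" "1/2" s] by linarith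
      moreover have "s * (1/2) = h * (\<rho> + 1)" by (simp add: s_def r_def)
      ultimately have "norm (T a) \<le> s" unfolding T_def
        using norm_triangle_ineq4[of "((1 + a \<bullet> a) / 2 * h) *\<^sub>R \<omega>" "q a a"] by linarith
      then show ?thesis by simp
    qed
    moreover have "continuous_on (cball 0 s) T"
      unfolding T_def[abs_def]
      by (intro continuous_intros bounded_bilinear.continuous_on[OF \<open>bounded_bilinear q\<close>]) simp
    ultimately obtain a where a: "a \<in> cball 0 s" "T a = a"
      using brouwer_ball[of s 0 T] s by blast
    define d where "d = 1 + a \<bullet> a"
    have d: "1 \<le> d" by (simp add: d_def)
    have "J *v a = ((d / 2 * h) *\<^sub>R (J *v \<omega>)) - cross3 a (J *v a)"
    proof -
      have "J *v a = J *v (T a)" by (simp add: a)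
      also have "\<dots> = ((d / 2 * h) *\<^sub>R (J *v \<omega>)) - cross3 a (J *v a)"
        by (simp add: T_def d_def q_def inv matrix_vector_mult_diff_distrib matrix_vector_mult_scaleR)
      finally show ?thesis .
    qed
    then have "J *v a + cross3 a (J *v a) = (d / 2 * h) *\<^sub>R (J *v \<omega>)" by (simp add: algebra_simps)
    then have eq: "cayley a ** \<J> - \<J> ** transpose (cayley a) = h *\<^sub>R cross_mat (J *v \<omega>)"
      using d cayley_inertia[OF J(1), of a, folded \<J>_def] by (simp add: cm.scaleR d_def[symmetric])
    have na: "norm a \<le> s" using a by simp
    have X: "norm (cross_mat a) \<le> Kc * s"
      using Kc(3)[of a] mult_left_mono[OF na, of Kc] Kc(1) by linarith
    have "norm (cross_mat a ** cross_mat a) \<le> (Kc * s) * (Kc * s) * K"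
      using X K s Kc by (intro order_trans[OF K(2)] mult_right_mono mult_mono) auto
    also have "\<dots> = Kc * Kc * K * (s * s)" by (simp add: algebra_simps)
    also have "\<dots> \<le> Kc * Kc * K * s"
      using s s1 Kc K by (intro mult_left_mono) (auto simp: mult_left_le)
    finally have XX: "norm (cross_mat a + cross_mat a ** cross_mat a) \<le> (Kc + Kc * Kc * K) * s"
      using X norm_triangle_ineq[of "cross_mat a" "cross_mat a ** cross_mat a"] by (simp add: algebra_simps)
    have "\<bar>2 / d\<bar> \<le> 2" using d by (simp add: field_simps)
    then have "norm ((2 / d) *\<^sub>R (cross_mat a + cross_mat a ** cross_mat a)) \<le> 2 * ((Kc + Kc * Kc * K) * s)"
      unfolding norm_scaleR using XX by (intro mult_mono) auto
    then have 1: "norm (cayley a - mat 1) \<le> 2 * (Kc + Kc * Kc * K) * s"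
      by (simp only: cayley_def d_def add_diff_cancel_left' mult.assoc)
    have 2: "norm (mat_exp (h *\<^sub>R cross_mat \<omega>) - mat 1) \<le> c * (Kc * (\<rho> + 1) * h)"
      using \<omega> Kh by (intro Kc h) auto
    have "norm (cayley a - mat_exp (h *\<^sub>R cross_mat \<omega>)) \<le>
        norm (cayley a - mat 1) + norm (mat_exp (h *\<^sub>R cross_mat \<omega>) - mat 1)"
      using norm_triangle_ineq4[of "cayley a - mat 1" "mat_exp (h *\<^sub>R cross_mat \<omega>) - mat 1"] by simp
    also have "\<dots> \<le> M * h" using 1 2 by (simp add: M_def s_def r_def algebra_simps)
    finally have "norm (cayley a - mat_exp (h *\<^sub>R cross_mat \<omega>)) < \<epsilon>" using Mh by simp
    then show ?thesis using eq h rotation_matrix_cayley[of a] by (intro exI[of _ "cayley a"]) simp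
  qed
  ultimately show ?thesis by blast
qed

section \<open>Rates of the estimator\<close>

lemmas uclose_matrix_mult = uclose_bilinear[OF bounded_bilinear_matrix_mult]
  and uclose_matrix_vector_mult = uclose_bilinear[OF bounded_bilinear_matrix_vector_mult]
  and uclose_cross3 = uclose_bilinear[OF bounded_bilinear_cross3]
  and uclose_scaleR = uclose_bilinear[OF bounded_bilinear_scaleR]
  and uclose_transpose = uclose_linear[OF bounded_linear_transpose]
  and uclose_rot = uclose_linear[OF bounded_linear_rot]
  and uclose_trans_part = uclose_linear[OF bounded_linear_trans_part]
  and uclose_upper = uclose_linear[OF bounded_linear_upper]
  and uclose_lower = uclose_linear[OF bounded_linear_lower]
  and uclose_trace = uclose_linear[OF bounded_linear_trace]
  and uclose_cross_mat = uclose_linear[OF bounded_linear_cross_mat]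
  and uclose_skew_vec = uclose_linear[OF bounded_linear_skew_vec]

lemma uclose_block_vec:
  assumes "uclose Q r x1 x2" "uclose Q r y1 y2"
  shows "uclose Q r (\<lambda>q. block_vec (x1 q) (y1 q)) (\<lambda>q. block_vec (x2 q) (y2 q))"
  using uclose_add[OF uclose_linear[OF bounded_linear_block_vec_left assms(1)]
      uclose_linear[OF bounded_linear_block_vec_right assms(2)]]
  by (simp add: block_vec_add)

lemma bounded_linear_vee: "bounded_linear vee"
proof (subst linear_conv_bounded_linear[symmetric], rule linearI)
  note up = bounded_linear.linear[OF bounded_linear_upper]
  note lo = bounded_linear.linear[OF bounded_linear_lower]
  note cm = bounded_linear.linear[OF bounded_linear_cross_mat]
  show "vee (x + y) = vee x + vee y" for x y
    by (simp add: vee_def linear_add[OF up] linear_add[OF lo] linear_add[OF cm])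
       (simp add: vec_eq_iff block_mat_def columnvector_def split: sum.split)
  show "vee (c *\<^sub>R x) = c *\<^sub>R vee x" for c x
    by (simp add: vee_def linear_scale[OF up] linear_scale[OF lo] linear_scale[OF cm])
       (simp add: vec_eq_iff block_mat_def columnvector_def split: sum.split)
qed

lemmas uclose_vee = uclose_linear[OF bounded_linear_vee]

lemmas uclose_intros = uclose_const uclose_add uclose_diff uclose_minus uclose_matrix_mult
  uclose_matrix_vector_mult uclose_cross3 uclose_scaleR uclose_transpose uclose_rot
  uclose_trans_part uclose_upper uclose_lower uclose_trace uclose_cross_mat uclose_skew_vec
  uclose_block_vec uclose_vee

section \<open>Lipschitz functions of time and their first-order expansion\<close>

lemma uclose_lipschitz:
  assumes f: "B-lipschitz_on {a..b::real} f" and r: "\<And>q. q \<in> Q \<Longrightarrow> \<bar>s1 q - s2 q\<bar> \<le> r q"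
    and s: "\<And>q. q \<in> Q \<Longrightarrow> s1 q \<in> {a..b}" "\<And>q. q \<in> Q \<Longrightarrow> s2 q \<in> {a..b}"
  shows "uclose Q r (\<lambda>q. f (s1 q)) (\<lambda>q. f (s2 q))"
proof -
  have B: "0 \<le> B" using f by (rule lipschitz_on_nonneg)
  have "compact (f ` {a..b})"
    by (intro compact_continuous_image lipschitz_on_continuous_on[OF f] compact_Icc)
  then obtain C where C: "0 < C" "\<And>t. t \<in> {a..b} \<Longrightarrow> norm (f t) \<le> C"
    by (auto dest!: compact_imp_bounded simp: bounded_pos)
  show ?thesis
  proof (rule ucloseI)
    show "ubounded Q (\<lambda>q. f (s1 q))" "ubounded Q (\<lambda>q. f (s2 q))"
      using C s by (auto intro!: ubigoI[where C=C])
    show "ubigo Q r (\<lambda>q. f (s1 q) - f (s2 q))"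
    proof (rule ubigoI[OF _ B])
      fix q assume q: "q \<in> Q"
      have "norm (f (s1 q) - f (s2 q)) \<le> B * \<bar>s1 q - s2 q\<bar>"
        using lipschitz_onD[OF f s(1)[OF q] s(2)[OF q]] by (simp add: dist_norm)
      also have "\<dots> \<le> B * r q" using r[OF q] B by (rule mult_left_mono)
      finally show "norm (f (s1 q) - f (s2 q)) \<le> B * r q" .
    qed
  qed
qed

lemma lipschitz_if_bounded_derivative:
  fixes u :: "real \<Rightarrow> 'a::real_normed_vector"
  assumes "\<And>t. t \<in> {a..b} \<Longrightarrow> (u has_vector_derivative u' t) (at t within {a..b})"
    and "ubounded {a..b} u'"
  shows "\<exists>B. B-lipschitz_on {a..b} u"
proof -
  obtain C where C: "0 \<le> C" "\<And>t. t \<in> {a..b} \<Longrightarrow> norm (u' t) \<le> C * 1"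
    using assms(2) by (rule ubigoE) blast
  have "C-lipschitz_on {a..b} u"
  proof (rule bounded_derivative_imp_lipschitz)
    show "(u has_derivative (\<lambda>h. h *\<^sub>R u' t)) (at t within {a..b})" if "t \<in> {a..b}" for t
      using assms(1)[OF that] by (simp add: has_vector_derivative_def)
    show "onorm (\<lambda>h. h *\<^sub>R u' t) \<le> C" if "t \<in> {a..b}" for t
      using mult_right_mono[OF C(2)[OF that] abs_ge_zero] by (intro onorm_le) (simp add: mult.commute)
  qed (use C in auto)
  then show ?thesis ..
qed

text \<open>The mean value inequality is applied to \<open>u s - s *\<^sub>R u' t\<close>, whose
  derivative \<open>u' s - u' t\<close> is at most \<open>B * h\<close> on the step. No second
  derivative is available, as the rates are no smoother in time than the measured signals.\<close>

lemma taylor_remainder_lipschitz: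
  fixes u :: "real \<Rightarrow> 'a::real_normed_vector"
  assumes "\<And>t. t \<in> {a..b} \<Longrightarrow> (u has_vector_derivative u' t) (at t within {a..b})"
    and B: "B-lipschitz_on {a..b} u'" and t: "a \<le> t" "0 \<le> h" "t + h \<le> b"
  shows "norm (u (t + h) - u t - h *\<^sub>R u' t) \<le> B * h\<^sup>2"
proof -
  have sub: "{t..t+h} \<subseteq> {a..b}" using t by auto
  have "norm ((u (t + h) - (t + h) *\<^sub>R u' t) - (u t - t *\<^sub>R u' t)) \<le> (B * h) * norm ((t + h) - t)"
  proof (rule differentiable_bound[where S="{t..t+h}" and f'="\<lambda>s k. k *\<^sub>R (u' s - u' t)"])
    fix s assume s: "s \<in> {t..t+h}"
    have "((\<lambda>s. s *\<^sub>R u' t) has_vector_derivative u' t) (at s within {t..t+h})"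
      unfolding has_vector_derivative_def
      by (rule bounded_linear_imp_has_derivative[OF bounded_linear_scaleR_left])
    then have "((\<lambda>s. u s - s *\<^sub>R u' t) has_vector_derivative (u' s - u' t)) (at s within {t..t+h})"
      using s sub by (intro has_vector_derivative_diff has_vector_derivative_within_subset[OF assms(1)]) auto
    then show "((\<lambda>s. u s - s *\<^sub>R u' t) has_derivative (\<lambda>k. k *\<^sub>R (u' s - u' t))) (at s within {t..t+h})"
      by (simp add: has_vector_derivative_def)
    have "norm (u' s - u' t) \<le> B * \<bar>s - t\<bar>"
      using lipschitz_onD[OF B, of s t] s t by (simp add: dist_norm)
    also have "\<dots> \<le> B * h" using s lipschitz_on_nonneg[OF B] by (intro mult_left_mono) auto
    finally have "norm (u' s - u' t) \<le> B * h" .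
    then show "onorm (\<lambda>k. k *\<^sub>R (u' s - u' t)) \<le> B * h"
      by (intro onorm_le) (simp add: mult.commute[of _ "\<bar>_\<bar>"] mult_left_mono)
  qed (use t in auto)
  then show ?thesis using t by (simp add: algebra_simps power2_eq_square)
qed

section \<open>One update of a momentum or of the pose, compared with an Euler step\<close>

definition momentum_rate :: "real^3^3 \<Rightarrow> real^3^3 \<Rightarrow> real^3 \<Rightarrow> real^3 \<Rightarrow> real^3 \<Rightarrow> real^3" where
  "momentum_rate A B \<omega> k x = matrix_inv A *v (k - cross3 \<omega> (A *v x) - B *v x)"

lemma uclose_momentum_rate:
  assumes "uclose Q r \<omega>1 \<omega>2" "uclose Q r k1 k2" "uclose Q r x1 x2"
  shows "uclose Q r (\<lambda>q. momentum_rate A B (\<omega>1 q) (k1 q) (x1 q)) (\<lambda>q. momentum_rate A B (\<omega>2 q) (k2 q) (x2 q))"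
  unfolding momentum_rate_def by (intro uclose_intros assms)

text \<open>One scheme for both momenta: \<open>A\<close>, \<open>B\<close>, \<open>x\<close> stand
  for \<open>J\<close>, \<open>Dr\<close>, \<open>\<omega>\<close> or for \<open>M\<close>,
  \<open>Dt\<close>, \<open>\<upsilon>\<close>. Up to \<open>h^2\<close>, \<open>transpose F\<close>
  is \<open>I - h \<omega>^x\<close>, which produces the gyroscopic term. Force and damping are
  taken at the new time; moving them to the old time costs \<open>h\<close> times an O(h)
  difference. Hence a bootstrap: \<open>x'\<close> is first bounded, then O(h)-close to
  \<open>x\<close>, then expanded.\<close>

lemma momentum_update:
  fixes h :: "'q \<Rightarrow> real" and F :: "'q \<Rightarrow> real^3^3" and \<omega> k k' x x' :: "'q \<Rightarrow> real^3"
  assumes AB: "pos_def A" "pos_def B" and h: "\<And>q. q \<in> Q \<Longrightarrow> 0 < h q" "\<And>q. q \<in> Q \<Longrightarrow> h q \<le> 1"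
    and x: "ubounded Q x" and \<omega>: "ubounded Q \<omega>" and k: "ubounded Q k" "ubigo Q h (\<lambda>q. k' q - k q)"
    and F: "ubigo Q (\<lambda>q. (h q)\<^sup>2) (\<lambda>q. F q - mat 1 - h q *\<^sub>R cross_mat (\<omega> q))"
    and eq: "\<And>q. q \<in> Q \<Longrightarrow> (A + h q *\<^sub>R B) *v x' q = transpose (F q) *v (A *v x q) + h q *\<^sub>R k' q"
  shows "ubigo Q (\<lambda>q. (h q)\<^sup>2) (\<lambda>q. x' q - x q - h q *\<^sub>R momentum_rate A B (\<omega> q) (k q) (x q))"
proof -
  interpret tr: bounded_linear "transpose :: real^3^3 \<Rightarrow> real^3^3" by (rule bounded_linear_transpose)
  interpret mv: bounded_bilinear "(*v) :: real^3^3 \<Rightarrow> real^3 \<Rightarrow> real^3"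
    by (rule bounded_bilinear_matrix_vector_mult)
  have h0: "\<And>q. q \<in> Q \<Longrightarrow> 0 \<le> h q" using h(1) by (simp add: less_imp_le)
  have hh: "\<And>q. q \<in> Q \<Longrightarrow> (h q)\<^sup>2 \<le> h q" using h by (simp add: power2_eq_square less_imp_le mult_left_le)
  note left = ubigo_bilinear_left[OF bounded_bilinear_matrix_vector_mult]
  note lin = ubigo_linear[OF matrix_vector_mul_bounded_linear]
  define P where "P q = transpose (F q) - mat 1" for q
  have P2: "ubigo Q (\<lambda>q. (h q)\<^sup>2) (\<lambda>q. P q + h q *\<^sub>R cross_mat (\<omega> q))"
    using ubigo_linear[OF bounded_linear_transpose F]
    by (simp add: P_def tr.diff tr.scaleR transpose_cross_mat)
  have "ubigo Q (\<lambda>q. h q * 1) (\<lambda>q. h q *\<^sub>R cross_mat (\<omega> q))"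
    by (rule ubigo_scaleR[OF ubigo_linear[OF bounded_linear_cross_mat \<omega>] h0])
  from ubigo_diff[OF ubigo_mono[OF P2 hh] this[simplified]] have P1: "ubigo Q h P" by simp
  have Ax: "ubounded Q (\<lambda>q. A *v x q)" by (rule lin[OF x])
  have one: "\<And>q. q \<in> Q \<Longrightarrow> h q \<le> 1" by (rule h)
  have k': "ubounded Q k'" using ubigo_add[OF k(1) ubigo_mono[OF k(2) one]] by simp
  have "ubigo Q (\<lambda>q. h q * 1) (\<lambda>q. h q *\<^sub>R k' q)" by (rule ubigo_scaleR[OF k' h0])
  then have hk': "ubigo Q h (\<lambda>q. h q *\<^sub>R k' q)" by simp
  note PAx = left[OF P1 Ax]
  have "ubounded Q (\<lambda>q. (A *v x q + P q *v (A *v x q)) + h q *\<^sub>R k' q)"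
    by (intro ubigo_add Ax ubigo_mono[OF PAx one] ubigo_mono[OF hk' one])
  then have "ubounded Q (\<lambda>q. (A + h q *\<^sub>R B) *v x' q)"
    by (rule ubigo_cong) (simp add: eq P_def mv.diff_left)
  then obtain C where C: "0 \<le> C" "\<And>q. q \<in> Q \<Longrightarrow> norm ((A + h q *\<^sub>R B) *v x' q) \<le> C * 1"
    by (rule ubigoE) blast
  obtain c where c: "0 < c" "\<And>x. c * (norm x)\<^sup>2 \<le> x \<bullet> (A *v x)" using pos_def_coercive[OF AB(1)] by blast
  \<comment> \<open>\<open>B\<close> only adds a nonnegative form, so the coercivity constant of
    \<open>A\<close> serves for \<open>A + h B\<close> whatever \<open>h\<close> is.\<close>
  have x': "ubounded Q x'"
  proof (rule ubigoI[where C="C / c"])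
    fix q assume q: "q \<in> Q"
    have "c * (norm z)\<^sup>2 \<le> z \<bullet> ((A + h q *\<^sub>R B) *v z)" for z
    proof -
      have "0 \<le> z \<bullet> (B *v z)" using AB(2) unfolding pos_def_def by (cases "z = 0") (auto intro: less_imp_le)
      then show ?thesis using c(2)[of z] h0[OF q] by (simp add: mv.add_left mv.scaleR_left inner_add_right add_increasing2)
    qed
    from coercive_bound[OF c(1) this, of "x' q"] C(2)[OF q] show "norm (x' q) \<le> C / c * 1"
      using c(1) by (simp add: field_simps)
  qed (use C c in simp)
  have "ubigo Q (\<lambda>q. h q * 1) (\<lambda>q. h q *\<^sub>R (B *v x' q))" by (rule ubigo_scaleR[OF lin[OF x'] h0])
  then have "ubigo Q h (\<lambda>q. P q *v (A *v x q) + h q *\<^sub>R k' q - h q *\<^sub>R (B *v x' q))"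
    by (intro ubigo_diff ubigo_add PAx hk') simp
  then have dx: "ubigo Q h (\<lambda>q. matrix_inv A *v (P q *v (A *v x q) + h q *\<^sub>R k' q - h q *\<^sub>R (B *v x' q)))"
    by (rule lin)
  have inv: "matrix_inv A *v (A *v z) = z" for z
    by (rule matrix_inv_mult_vec[OF pos_def_invertible[OF AB(1)]])
  have expand: "P q *v (A *v x q) + h q *\<^sub>R k' q - h q *\<^sub>R (B *v x' q) = A *v (x' q - x q)" if "q \<in> Q" for q
    using eq[OF that] by (simp add: P_def mv.diff_left mv.add_left mv.scaleR_left mv.diff_right algebra_simps)
  have dx: "ubigo Q h (\<lambda>q. x' q - x q)" using dx by (rule ubigo_cong) (simp only: expand inv)
  have "ubigo Q (\<lambda>q. (h q)\<^sup>2) (\<lambda>q. (P q + h q *\<^sub>R cross_mat (\<omega> q)) *v (A *v x q)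
        + h q *\<^sub>R (k' q - k q) - h q *\<^sub>R (B *v (x' q - x q)))"
    using ubigo_scaleR[OF k(2) h0] ubigo_scaleR[OF lin[OF dx] h0]
    by (intro ubigo_diff ubigo_add left[OF P2 Ax]) (simp_all add: power2_eq_square)
  then have "ubigo Q (\<lambda>q. (h q)\<^sup>2) (\<lambda>q. matrix_inv A *v ((P q + h q *\<^sub>R cross_mat (\<omega> q)) *v (A *v x q)
        + h q *\<^sub>R (k' q - k q) - h q *\<^sub>R (B *v (x' q - x q))))"
    by (rule lin)
  then show ?thesis
  proof (rule ubigo_cong)
    fix q assume "q \<in> Q"
    have "(P q + h q *\<^sub>R cross_mat (\<omega> q)) *v (A *v x q) + h q *\<^sub>R (k' q - k q) - h q *\<^sub>R (B *v (x' q - x q))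
        = (P q *v (A *v x q) + h q *\<^sub>R k' q - h q *\<^sub>R (B *v x' q))
          - h q *\<^sub>R (k q - cross3 (\<omega> q) (A *v x q) - B *v x q)"
      by (simp add: mv.add_left mv.scaleR_left mv.diff_right cross_mat_mult_vec algebra_simps)
    also have "\<dots> = A *v (x' q - x q) - h q *\<^sub>R (k q - cross3 (\<omega> q) (A *v x q) - B *v x q)"
      by (simp only: expand[OF \<open>q \<in> Q\<close>])
    finally show "matrix_inv A *v ((P q + h q *\<^sub>R cross_mat (\<omega> q)) *v (A *v x q) + h q *\<^sub>R (k' q - k q) - h q *\<^sub>R (B *v (x' q - x q)))
        = x' q - x q - h q *\<^sub>R momentum_rate A B (\<omega> q) (k q) (x q)"
      by (simp only: mv.diff_right mv.scaleR_right inv momentum_rate_def)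
  qed
qed

lemma pose_update:
  fixes g \<xi> :: "'q \<Rightarrow> real^'n^'n"
  assumes h: "\<And>q. q \<in> Q \<Longrightarrow> 0 < h q" "\<And>q. q \<in> Q \<Longrightarrow> h q \<le> 1"
    and g: "ubounded Q g" and \<xi>: "ubounded Q \<xi>"
    and eq: "\<And>q. q \<in> Q \<Longrightarrow> g' q = g q ** mat_exp (h q *\<^sub>R \<xi> q)"
  shows "ubigo Q (\<lambda>q. (h q)\<^sup>2) (\<lambda>q. g' q - g q - h q *\<^sub>R (g q ** \<xi> q))"
proof -
  interpret mm: bounded_bilinear "(**) :: real^'n^'n \<Rightarrow> real^'n^'n \<Rightarrow> real^'n^'n"
    by (rule bounded_bilinear_matrix_mult)
  obtain C where C: "0 \<le> C" "\<And>q. q \<in> Q \<Longrightarrow> norm (\<xi> q) \<le> C * 1" using \<xi> by (rule ubigoE) blast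
  obtain c where c: "0 \<le> c" "\<And>A::real^'n^'n. norm A \<le> C \<Longrightarrow> norm (mat_exp A - mat 1 - A) \<le> c * (norm A)\<^sup>2"
    using mat_exp_expansion[of C] by blast
  have "ubigo Q (\<lambda>q. (h q)\<^sup>2) (\<lambda>q. mat_exp (h q *\<^sub>R \<xi> q) - mat 1 - h q *\<^sub>R \<xi> q)"
  proof (rule ubigoI[where C="c * C\<^sup>2"])
    fix q assume q: "q \<in> Q"
    have n: "norm (h q *\<^sub>R \<xi> q) \<le> h q * C" using C(2)[OF q] h[OF q] by simp
    also have "\<dots> \<le> C" using h(2)[OF q] C(1) by (simp add: mult_left_le_one_le h(1) q less_imp_le)
    finally have "norm (mat_exp (h q *\<^sub>R \<xi> q) - mat 1 - h q *\<^sub>R \<xi> q) \<le> c * (norm (h q *\<^sub>R \<xi> q))\<^sup>2"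
      by (rule c)
    also have "\<dots> \<le> c * (h q * C)\<^sup>2" using n c(1) by (intro mult_left_mono power_mono) auto
    finally show "norm (mat_exp (h q *\<^sub>R \<xi> q) - mat 1 - h q *\<^sub>R \<xi> q) \<le> c * C\<^sup>2 * (h q)\<^sup>2"
      by (simp add: power_mult_distrib mult.commute mult.left_commute)
  qed (use c in simp)
  from ubigo_bilinear_right[OF bounded_bilinear_matrix_mult g this] show ?thesis
    by (rule ubigo_cong) (simp add: eq mm.diff_right mm.scaleR_right)
qed

text \<open>Both increments are Euler increments up to \<open>h^2\<close>, so apart from this only
  \<open>h\<close> times the difference of the rates is added. The old error keeps the factor 1,
  without which the errors would grow geometrically with the number of steps.\<close>

lemma one_step_error:
  fixes u v u' v' r s :: "'q \<Rightarrow> 'a::real_normed_vector"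
  assumes h: "\<And>q. q \<in> Q \<Longrightarrow> 0 \<le> h q"
    and u: "ubigo Q (\<lambda>q. (h q)\<^sup>2) (\<lambda>q. u' q - u q - h q *\<^sub>R r q)"
    and v: "ubigo Q (\<lambda>q. (h q)\<^sup>2) (\<lambda>q. v' q - v q - h q *\<^sub>R s q)"
    and rs: "ubigo Q e (\<lambda>q. r q - s q)"
  shows "\<exists>L\<ge>0. \<exists>C\<ge>0. \<forall>q\<in>Q. norm (u' q - v' q) \<le> norm (u q - v q) + L * h q * e q + C * (h q)\<^sup>2"
proof -
  have "ubigo Q (\<lambda>q. (h q)\<^sup>2) (\<lambda>q. (u' q - u q - h q *\<^sub>R r q) - (v' q - v q - h q *\<^sub>R s q))"
    using u v by (rule ubigo_diff)
  then obtain C where C: "0 \<le> C" "\<And>q. q \<in> Q \<Longrightarrow>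
      norm ((u' q - u q - h q *\<^sub>R r q) - (v' q - v q - h q *\<^sub>R s q)) \<le> C * (h q)\<^sup>2"
    by (rule ubigoE) blast
  obtain L where L: "0 \<le> L" "\<And>q. q \<in> Q \<Longrightarrow> norm (r q - s q) \<le> L * e q" using rs by (rule ubigoE) blast
  have "norm (u' q - v' q) \<le> norm (u q - v q) + L * h q * e q + C * (h q)\<^sup>2" if q: "q \<in> Q" for q
  proof -
    have "u' q - v' q = ((u q - v q) + h q *\<^sub>R (r q - s q))
        + ((u' q - u q - h q *\<^sub>R r q) - (v' q - v q - h q *\<^sub>R s q))" by (simp add: algebra_simps)
    then have "norm (u' q - v' q) \<le> norm ((u q - v q) + h q *\<^sub>R (r q - s q))
        + norm ((u' q - u q - h q *\<^sub>R r q) - (v' q - v q - h q *\<^sub>R s q))"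
      by (simp only: norm_triangle_ineq)
    then have "norm (u' q - v' q) \<le> norm (u q - v q) + norm (h q *\<^sub>R (r q - s q)) + C * (h q)\<^sup>2"
      using C(2)[OF q] norm_triangle_ineq[of "u q - v q" "h q *\<^sub>R (r q - s q)"] by linarith
    moreover have "norm (h q *\<^sub>R (r q - s q)) \<le> h q * (L * e q)"
      using L(2)[OF q] h[OF q] by (simp add: mult_left_mono)
    ultimately show ?thesis by (simp add: ac_simps)
  qed
  then show ?thesis using L C by blast
qed

text \<open>\<open>f\<close> is controlled on the half line only, hence the sign conditions on its
  arguments. Their boundedness confines them to one compact interval, on which the continuous
  derivative is bounded.\<close>

lemma uclose_C1_half_line:
  fixes f f' :: "real \<Rightarrow> real"
  assumes f: "\<And>x. 0 \<le> x \<Longrightarrow> (f has_real_derivative f' x) (at x within {0..})"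
    and f': "continuous_on {0..} f'"
    and u: "uclose Q r u1 u2" "\<And>q. q \<in> Q \<Longrightarrow> 0 \<le> u1 q" "\<And>q. q \<in> Q \<Longrightarrow> 0 \<le> u2 q"
  shows "uclose Q r (\<lambda>q. f (u1 q)) (\<lambda>q. f (u2 q))"
proof -
  obtain C1 where C1: "0 \<le> C1" "\<And>q. q \<in> Q \<Longrightarrow> norm (u1 q) \<le> C1 * 1"
    using ucloseD(1)[OF u(1)] by (rule ubigoE) blast
  obtain C2 where C2: "0 \<le> C2" "\<And>q. q \<in> Q \<Longrightarrow> norm (u2 q) \<le> C2 * 1"
    using ucloseD(2)[OF u(1)] by (rule ubigoE) blast
  define C where "C = C1 + C2"
  have in_C: "u1 q \<in> {0..C}" "u2 q \<in> {0..C}" if "q \<in> Q" for q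
    using C1(1) C2(1) u(2,3)[OF that] C1(2)[OF that] C2(2)[OF that] by (auto simp: C_def)
  have "compact (f' ` {0..C})"
    by (intro compact_continuous_image continuous_on_subset[OF f'] compact_Icc) auto
  then obtain B where B: "0 < B" "\<And>t. t \<in> {0..C} \<Longrightarrow> norm (f' t) \<le> B"
    by (auto dest!: compact_imp_bounded simp: bounded_pos)
  have "ubounded {0..C} f'" using B by (intro ubigoI[where C=B]) auto
  moreover have "(f has_vector_derivative f' t) (at t within {0..C})" if "t \<in> {0..C}" for t
    using that by (intro has_vector_derivative_within_subset[OF
          f[unfolded has_real_derivative_iff_has_vector_derivative]]) auto
  ultimately obtain L where L: "L-lipschitz_on {0..C} f" using lipschitz_if_bounded_derivative by blast
  \<comment> \<open>\<open>uclose_lipschitz\<close> leaves no room for a constant in the bound on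
    the arguments. Closeness is therefore first measured by their own distance, and its O(r) bound
    is inserted afterwards.\<close>
  have "uclose Q (\<lambda>q. \<bar>u1 q - u2 q\<bar>) (\<lambda>q. f (u1 q)) (\<lambda>q. f (u2 q))"
    by (rule uclose_lipschitz[OF L]) (use in_C in auto)
  then obtain K where K: "0 \<le> K" "\<And>q. q \<in> Q \<Longrightarrow> norm (f (u1 q) - f (u2 q)) \<le> K * \<bar>u1 q - u2 q\<bar>"
    and bd: "ubounded Q (\<lambda>q. f (u1 q))" "ubounded Q (\<lambda>q. f (u2 q))"
    unfolding uclose_def by (auto elim!: ubigoE)
  obtain D where D: "0 \<le> D" "\<And>q. q \<in> Q \<Longrightarrow> norm (u1 q - u2 q) \<le> D * r q"
    using ucloseD(3)[OF u(1)] by (rule ubigoE) blast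
  have "norm (f (u1 q) - f (u2 q)) \<le> K * D * r q" if "q \<in> Q" for q
    using order_trans[OF K(2)[OF that] mult_left_mono[OF D(2)[OF that, unfolded real_norm_def] K(1)]]
    by (simp add: mult.assoc)
  then have "ubigo Q r (\<lambda>q. f (u1 q) - f (u2 q))" using K D by (intro ubigoI[where C="K * D"]) auto
  then show ?thesis using bd by (intro ucloseI)
qed

section \<open>The potential, the forces and the velocity estimate\<close>

lemma U_rot_nonneg:
  assumes "pos_def W"
  shows "0 \<le> U_rot W g L D"
proof -
  have W: "0 \<le> x \<bullet> (W *v x)" for x
    using assms unfolding pos_def_def by (cases "x = 0") (auto intro: less_imp_le)
  \<comment> \<open>Row by row, the trace is a sum of values of the quadratic form of
    \<open>W\<close>. The argument covers arbitrary \<open>E\<close>, so it applies to numerical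
    poses as well.\<close>
  have "frob E (E ** W) = (\<Sum>i\<in>UNIV. E $ i \<bullet> (transpose W *v E $ i))" for E :: "real^'a^3"
    unfolding frob_def trace_def matrix_matrix_mult_def matrix_vector_mult_def transpose_def inner_vec_def
    by (subst sum.swap) (simp add: mult.commute)
  moreover have "x \<bullet> (transpose W *v x) = x \<bullet> (W *v x)" for x :: "real^'a"
    by (metis dot_lmul_matrix inner_commute transpose_matrix_vector)
  ultimately show ?thesis unfolding U_rot_def by (simp add: W sum_nonneg)
qed

lemma S_Gamma_skew_vec: "S_Gamma W R L D = skew_vec (D ** W ** transpose L ** transpose R)"
  using vex_diff_transpose[of "D ** W ** transpose L ** transpose R"]
  by (simp add: S_Gamma_def Let_def matrix_transpose_mul matrix_mul_assoc)

text \<open>The two forces are the negated blocks of \<open>Z_term\<close>, arranged as in the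
  discrete equations. In the rotational one \<open>p \<times> p = 0\<close> removes \<open>p\<close>
  from \<open>y\<close>, and \<open>cross3 (M *v \<upsilon>) \<upsilon>\<close> is the part of the
  coadjoint term that \<open>momentum_rate\<close> lacks.\<close>

definition translational_force :: "real \<Rightarrow> pose \<Rightarrow> real^3 \<Rightarrow> real^3 \<Rightarrow> real^3" where
  "translational_force \<kappa> g a p = \<kappa> *\<^sub>R (trans_part g + rot g *v a - p)"

definition rotational_force ::
  "real^3^3 \<Rightarrow> real \<Rightarrow> real^'n^'n \<Rightarrow> (real \<Rightarrow> real) \<Rightarrow> pose \<Rightarrow> real^'n^3 \<Rightarrow> real^'n^3 \<Rightarrow> real^3 \<Rightarrow> real^3 \<Rightarrow> real^3 \<Rightarrow> real^3"
  where
  "rotational_force M \<kappa> W d\<Phi> g L D a p \<upsilon> = cross3 (M *v \<upsilon>) \<upsilon> + \<kappa> *\<^sub>R cross3 p (trans_part g + rot g *v a)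
     - d\<Phi> (U_rot W g L D) *\<^sub>R S_Gamma W (rot g) L D"

definition velocity_estimate :: "twist \<Rightarrow> pose \<Rightarrow> twist \<Rightarrow> twist" where
  "velocity_estimate x g \<phi> = x - Ad (matrix_inv g) *v \<phi>"

lemma uclose_translational_force:
  assumes "uclose Q r g1 g2" "uclose Q r a1 a2" "uclose Q r p1 p2"
  shows "uclose Q r (\<lambda>q. translational_force \<kappa> (g1 q) (a1 q) (p1 q)) (\<lambda>q. translational_force \<kappa> (g2 q) (a2 q) (p2 q))"
  unfolding translational_force_def by (intro uclose_intros assms)

lemma uclose_rotational_force:
  assumes W: "pos_def W" and d\<Phi>: "\<And>x. 0 \<le> x \<Longrightarrow> (d\<Phi> has_real_derivative dd\<Phi> x) (at x within {0..})"
    "continuous_on {0..} dd\<Phi>"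
    and close: "uclose Q r g1 g2" "uclose Q r L1 L2" "uclose Q r D1 D2" "uclose Q r a1 a2" "uclose Q r p1 p2"
    "uclose Q r v1 v2"
  shows "uclose Q r (\<lambda>q. rotational_force M \<kappa> W d\<Phi> (g1 q) (L1 q) (D1 q) (a1 q) (p1 q) (v1 q))
      (\<lambda>q. rotational_force M \<kappa> W d\<Phi> (g2 q) (L2 q) (D2 q) (a2 q) (p2 q) (v2 q))"
proof -
  have "uclose Q r (\<lambda>q. U_rot W (g1 q) (L1 q) (D1 q)) (\<lambda>q. U_rot W (g2 q) (L2 q) (D2 q))"
    unfolding U_rot_def frob_def
    by (intro uclose_linear[OF bounded_linear_mult_right] uclose_intros close)
  then have "uclose Q r (\<lambda>q. d\<Phi> (U_rot W (g1 q) (L1 q) (D1 q))) (\<lambda>q. d\<Phi> (U_rot W (g2 q) (L2 q) (D2 q)))"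
    using U_rot_nonneg[OF W] by (intro uclose_C1_half_line[OF d\<Phi>])
  then show ?thesis
    unfolding rotational_force_def S_Gamma_skew_vec by (intro uclose_intros close)
qed

text \<open>The pose enters through its inverse, which depends on it in a Lipschitz way only on
  matrices with a common lower bound; this is where invertibility of the numerical pose is
  used.\<close>

lemma uclose_velocity_estimate:
  assumes "uclose Q r x1 x2" "uclose Q r g1 g2" "uclose Q r \<phi>1 \<phi>2" "0 < m"
    "\<And>q z. q \<in> Q \<Longrightarrow> m * norm z \<le> norm (g1 q *v z)" "\<And>q z. q \<in> Q \<Longrightarrow> m * norm z \<le> norm (g2 q *v z)"
  shows "uclose Q r (\<lambda>q. velocity_estimate (x1 q) (g1 q) (\<phi>1 q)) (\<lambda>q. velocity_estimate (x2 q) (g2 q) (\<phi>2 q))"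
  unfolding velocity_estimate_def Ad_def block_mat_mult_vec
  by (intro uclose_intros uclose_matrix_inv[OF assms(2,4)] assms)

lemma ubigo_compose: "ubounded S f \<Longrightarrow> (\<And>q. q \<in> Q \<Longrightarrow> s q \<in> S) \<Longrightarrow> ubounded Q (\<lambda>q. f (s q))"
  unfolding ubigo_def by auto

lemma ubounded_continuous:
  fixes f :: "real \<Rightarrow> 'a::real_normed_vector"
  assumes "continuous_on {a..b} f"
  shows "ubounded {a..b} f"
proof -
  have "compact (f ` {a..b})" by (intro compact_continuous_image assms compact_Icc)
  then obtain C where "0 < C" "\<And>t. t \<in> {a..b} \<Longrightarrow> norm (f t) \<le> C"
    by (auto dest!: compact_imp_bounded simp: bounded_pos)
  then show ?thesis by (intro ubigoI[where C=C]) auto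
qed

lemma ubigo_increment:
  assumes h: "\<And>q. q \<in> Q \<Longrightarrow> 0 < h q" "\<And>q. q \<in> Q \<Longrightarrow> h q \<le> 1"
    and x: "ubigo Q (\<lambda>q. (h q)\<^sup>2) (\<lambda>q. x' q - x q - h q *\<^sub>R r q)" and r: "ubounded Q r"
  shows "ubigo Q h (\<lambda>q. x' q - x q)"
proof -
  have "ubigo Q (\<lambda>q. h q * 1) (\<lambda>q. h q *\<^sub>R r q)"
    using h by (intro ubigo_scaleR r) (simp add: less_imp_le)
  moreover have "ubigo Q h (\<lambda>q. x' q - x q - h q *\<^sub>R r q)"
    using h by (intro ubigo_mono[OF x]) (simp add: power2_eq_square less_imp_le mult_left_le)
  ultimately have "ubigo Q h (\<lambda>q. (x' q - x q - h q *\<^sub>R r q) + h q *\<^sub>R r q)"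
    by (intro ubigo_add) auto
  then show ?thesis by simp
qed

text \<open>Closeness over pairs of times, with \<open>r\<close> their distance, is a Lipschitz
  bound. The closeness calculus thus also handles compound functions of time.\<close>

lemma lipschitz_if_uclose:
  assumes "uclose ({a..b} \<times> {a..b}) (\<lambda>q. \<bar>fst q - snd q\<bar>) (\<lambda>q. f (fst q)) (\<lambda>q. f (snd q :: real))"
  shows "\<exists>B. B-lipschitz_on {a..b} f"
proof -
  obtain B where B: "0 \<le> B" "\<And>q. q \<in> {a..b} \<times> {a..b} \<Longrightarrow> norm (f (fst q) - f (snd q)) \<le> B * \<bar>fst q - snd q\<bar>"
    using ucloseD(3)[OF assms] by (rule ubigoE) blast
  have "B-lipschitz_on {a..b} f"
  proof (rule lipschitz_onI)
    fix s t assume "s \<in> {a..b}" "t \<in> {a..b}"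
    then show "dist (f s) (f t) \<le> B * dist s t" using B(2)[of "(s, t)"] by (simp add: dist_norm)
  qed (rule B)
  then show ?thesis ..
qed

lemma ubigo_taylor:
  fixes u :: "real \<Rightarrow> 'a::real_normed_vector"
  assumes "\<And>t. t \<in> {a..b} \<Longrightarrow> (u has_vector_derivative u' t) (at t within {a..b})"
    and "\<exists>B. B-lipschitz_on {a..b} u'"
    and Q: "\<And>q. q \<in> Q \<Longrightarrow> a \<le> t q" "\<And>q. q \<in> Q \<Longrightarrow> 0 < h q" "\<And>q. q \<in> Q \<Longrightarrow> t q + h q \<le> b"
  shows "ubigo Q (\<lambda>q. (h q)\<^sup>2) (\<lambda>q. u (t q + h q) - u (t q) - h q *\<^sub>R u' (t q))"
proof -
  obtain B where B: "B-lipschitz_on {a..b} u'" using assms(2) ..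
  show ?thesis
  proof (rule ubigoI[OF _ lipschitz_on_nonneg[OF B]])
    fix q assume "q \<in> Q"
    from Q[OF this] show "norm (u (t q + h q) - u (t q) - h q *\<^sub>R u' (t q)) \<le> B * (h q)\<^sup>2"
      by (intro taylor_remainder_lipschitz[OF assms(1) B]) auto
  qed
qed

text \<open>Makes the two linear systems of a step uniquely solvable for every positive
  \<open>h\<close>.\<close>

lemma pos_def_add_scaleR:
  assumes "pos_def A" "pos_def B" "0 < h"
  shows "pos_def (A + h *\<^sub>R B)"
  unfolding pos_def_def
proof (intro allI impI)
  interpret mv: bounded_bilinear "(*v) :: real^'a^'a \<Rightarrow> real^'a \<Rightarrow> real^'a"
    by (rule bounded_bilinear_matrix_vector_mult)
  fix x :: "real^'a" assume "x \<noteq> 0"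
  then have "0 < x \<bullet> (A *v x)" "0 < x \<bullet> (B *v x)" using assms by (auto simp: pos_def_def)
  then show "0 < x \<bullet> ((A + h *\<^sub>R B) *v x)"
    using assms(3) by (simp add: mv.add_left mv.scaleR_left inner_add_right add_pos_pos)
qed

text \<open>Brings both velocity equations to the form treated by \<open>momentum_update\<close>,
  and the two relations for \<open>\<xi>\<close> to the form of an invariant that holds at either
  end of the step.\<close>

lemma estimator_step_iff:
  "estimator_step J M Dr Dt \<kappa> W d\<Phi> xim L D am pbar \<epsilon> t h (g, \<xi>, \<phi>) (g', \<xi>', \<phi>') \<longleftrightarrow>
    (\<exists>F. rotation_matrix F \<and> norm (F - mat_exp (h *\<^sub>R cross_mat (upper \<phi>))) < \<epsilon> \<and>
       cross_mat (J *v upper \<phi>) = (1 / h) *\<^sub>R (F ** ((1/2 * trace J) *\<^sub>R mat 1 - J)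
         - ((1/2 * trace J) *\<^sub>R mat 1 - J) ** transpose F) \<and>
       (M + h *\<^sub>R Dt) *v lower \<phi>' =
         transpose F *v (M *v lower \<phi>) + h *\<^sub>R translational_force \<kappa> g' (am (t + h)) (pbar (t + h)) \<and>
       (J + h *\<^sub>R Dr) *v upper \<phi>' = transpose F *v (J *v upper \<phi>)
         + h *\<^sub>R rotational_force M \<kappa> W d\<Phi> g' (L (t + h)) (D (t + h)) (am (t + h)) (pbar (t + h)) (lower \<phi>') \<and>
       \<xi> = velocity_estimate (xim t) g \<phi> \<and> \<xi>' = velocity_estimate (xim (t + h)) g' \<phi>' \<and>
       g' = g ** mat_exp (h *\<^sub>R vee \<xi>))"
  unfolding estimator_step_def Let_def translational_force_def rotational_force_def velocity_estimate_def
  by (simp add: cross_mat_mult_vec scaleR_add_right scaleR_diff_right add_diff_eq add.assoc)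


section \<open>The estimator and its discretization\<close>

locale estimator =
  fixes J M Dr Dt :: "real^3^3" and \<kappa> :: real and W :: "real^'n^'n"
    and d\<Phi> dd\<Phi> :: "real \<Rightarrow> real"
    and xim :: "real \<Rightarrow> twist" and L D :: "real \<Rightarrow> real^'n^3" and am pbar :: "real \<Rightarrow> real^3"
    and t0 T :: real and g :: "real \<Rightarrow> pose" and \<xi> \<phi> :: "real \<Rightarrow> twist"
  assumes J: "sym_mat J" "pos_def J" and M: "pos_def M" and Dr: "pos_def Dr" and Dt: "pos_def Dt"
    and W: "pos_def W"
    and d\<Phi>: "\<And>x. 0 \<le> x \<Longrightarrow> (d\<Phi> has_real_derivative dd\<Phi> x) (at x within {0..})"
      "continuous_on {0..} dd\<Phi>"
    and t0_less_T: "t0 < T"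
    and data: "\<exists>B. B-lipschitz_on {t0..T} xim" "\<exists>B. B-lipschitz_on {t0..T} L"
      "\<exists>B. B-lipschitz_on {t0..T} D" "\<exists>B. B-lipschitz_on {t0..T} am" "\<exists>B. B-lipschitz_on {t0..T} pbar"
    and solution: "estimator_solution J M Dr Dt \<kappa> W d\<Phi> xim L D am pbar {t0..T} g \<xi> \<phi>"
begin

text \<open>The estimator equations solved for the derivatives, with \<open>\<xi>\<close>
  eliminated. They are functions of an arbitrary matrix and twist, so that they can be evaluated
  along the exact solution and at numerical states alike.\<close>

definition pose_rate :: "real \<Rightarrow> pose \<Rightarrow> twist \<Rightarrow> pose" where
  "pose_rate t p \<psi> = p ** vee (velocity_estimate (xim t) p \<psi>)"

definition rotational_rate :: "real \<Rightarrow> pose \<Rightarrow> twist \<Rightarrow> real^3" where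
  "rotational_rate t p \<psi> = momentum_rate J Dr (upper \<psi>)
     (rotational_force M \<kappa> W d\<Phi> p (L t) (D t) (am t) (pbar t) (lower \<psi>)) (upper \<psi>)"

definition translational_rate :: "real \<Rightarrow> pose \<Rightarrow> twist \<Rightarrow> real^3" where
  "translational_rate t p \<psi> = momentum_rate M Dt (upper \<psi>)
     (translational_force \<kappa> p (am t) (pbar t)) (lower \<psi>)"

lemma uclose_data:
  assumes "\<And>q. q \<in> Q \<Longrightarrow> s1 q \<in> {t0..T}" "\<And>q. q \<in> Q \<Longrightarrow> s2 q \<in> {t0..T}"
    "\<And>q. q \<in> Q \<Longrightarrow> \<bar>s1 q - s2 q\<bar> \<le> r q"
  shows "uclose Q r (\<lambda>q. xim (s1 q)) (\<lambda>q. xim (s2 q))" "uclose Q r (\<lambda>q. L (s1 q)) (\<lambda>q. L (s2 q))"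
    "uclose Q r (\<lambda>q. D (s1 q)) (\<lambda>q. D (s2 q))" "uclose Q r (\<lambda>q. am (s1 q)) (\<lambda>q. am (s2 q))"
    "uclose Q r (\<lambda>q. pbar (s1 q)) (\<lambda>q. pbar (s2 q))"
proof -
  note close = uclose_lipschitz[OF _ assms(3,1,2)]
  obtain B1 B2 B3 B4 B5 where B: "B1-lipschitz_on {t0..T} xim" "B2-lipschitz_on {t0..T} L"
    "B3-lipschitz_on {t0..T} D" "B4-lipschitz_on {t0..T} am" "B5-lipschitz_on {t0..T} pbar"
    using data by blast
  show "uclose Q r (\<lambda>q. xim (s1 q)) (\<lambda>q. xim (s2 q))" by (rule close[OF B(1)])
  show "uclose Q r (\<lambda>q. L (s1 q)) (\<lambda>q. L (s2 q))" by (rule close[OF B(2)])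
  show "uclose Q r (\<lambda>q. D (s1 q)) (\<lambda>q. D (s2 q))" by (rule close[OF B(3)])
  show "uclose Q r (\<lambda>q. am (s1 q)) (\<lambda>q. am (s2 q))" by (rule close[OF B(4)])
  show "uclose Q r (\<lambda>q. pbar (s1 q)) (\<lambda>q. pbar (s2 q))" by (rule close[OF B(5)])
qed

text \<open>Used in three ways: for a numerical against an exact state at the same time, for the
  exact solution at two times, and for the exact solution against itself, where it yields
  boundedness of the rates.\<close>

lemma uclose_rates:
  assumes s: "\<And>q. q \<in> Q \<Longrightarrow> s1 q \<in> {t0..T}" "\<And>q. q \<in> Q \<Longrightarrow> s2 q \<in> {t0..T}"
    "\<And>q. q \<in> Q \<Longrightarrow> \<bar>s1 q - s2 q\<bar> \<le> r q"
    and close: "uclose Q r g1 g2" "uclose Q r \<phi>1 \<phi>2" and m: "0 < m"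
    "\<And>q z. q \<in> Q \<Longrightarrow> m * norm z \<le> norm (g1 q *v z)" "\<And>q z. q \<in> Q \<Longrightarrow> m * norm z \<le> norm (g2 q *v z)"
  shows "uclose Q r (\<lambda>q. velocity_estimate (xim (s1 q)) (g1 q) (\<phi>1 q)) (\<lambda>q. velocity_estimate (xim (s2 q)) (g2 q) (\<phi>2 q))"
    "uclose Q r (\<lambda>q. pose_rate (s1 q) (g1 q) (\<phi>1 q)) (\<lambda>q. pose_rate (s2 q) (g2 q) (\<phi>2 q))"
    "uclose Q r (\<lambda>q. rotational_rate (s1 q) (g1 q) (\<phi>1 q)) (\<lambda>q. rotational_rate (s2 q) (g2 q) (\<phi>2 q))"
    "uclose Q r (\<lambda>q. translational_rate (s1 q) (g1 q) (\<phi>1 q)) (\<lambda>q. translational_rate (s2 q) (g2 q) (\<phi>2 q))"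
proof -
  note data = uclose_data[OF s]
  show v: "uclose Q r (\<lambda>q. velocity_estimate (xim (s1 q)) (g1 q) (\<phi>1 q)) (\<lambda>q. velocity_estimate (xim (s2 q)) (g2 q) (\<phi>2 q))"
    by (rule uclose_velocity_estimate[OF data(1) close m])
  show "uclose Q r (\<lambda>q. pose_rate (s1 q) (g1 q) (\<phi>1 q)) (\<lambda>q. pose_rate (s2 q) (g2 q) (\<phi>2 q))"
    unfolding pose_rate_def by (intro uclose_intros v close)
  show "uclose Q r (\<lambda>q. rotational_rate (s1 q) (g1 q) (\<phi>1 q)) (\<lambda>q. rotational_rate (s2 q) (g2 q) (\<phi>2 q))"
    unfolding rotational_rate_def
    by (intro uclose_momentum_rate uclose_rotational_force[OF W d\<Phi>] uclose_upper uclose_lower data close)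
  show "uclose Q r (\<lambda>q. translational_rate (s1 q) (g1 q) (\<phi>1 q)) (\<lambda>q. translational_rate (s2 q) (g2 q) (\<phi>2 q))"
    unfolding translational_rate_def
    by (intro uclose_momentum_rate uclose_translational_force uclose_upper uclose_lower data close)
qed

lemma exact_solution:
  assumes t: "t \<in> {t0..T}"
  shows "g t \<in> SE3" "\<xi> t = velocity_estimate (xim t) (g t) (\<phi> t)"
    "(g has_vector_derivative pose_rate t (g t) (\<phi> t)) (at t within {t0..T})"
    "((\<lambda>t. upper (\<phi> t)) has_vector_derivative rotational_rate t (g t) (\<phi> t)) (at t within {t0..T})"
    "((\<lambda>t. lower (\<phi> t)) has_vector_derivative translational_rate t (g t) (\<phi> t)) (at t within {t0..T})"
    "continuous (at t within {t0..T}) \<phi>"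
proof -
  note sol = solution[unfolded estimator_solution_def, rule_format, OF t]
  show "g t \<in> SE3" and \<xi>: "\<xi> t = velocity_estimate (xim t) (g t) (\<phi> t)"
    using sol by (auto simp: velocity_estimate_def)
  show "(g has_vector_derivative pose_rate t (g t) (\<phi> t)) (at t within {t0..T})"
    unfolding pose_rate_def \<xi>[symmetric] using sol by blast
  obtain \<phi>' where \<phi>': "(\<phi> has_vector_derivative \<phi>') (at t within {t0..T})"
    and eq: "block_mat J 0 0 M *v \<phi>' = ad_star (\<phi> t) *v (block_mat J 0 0 M *v \<phi> t)
             - Z_term d\<Phi> \<kappa> W (g t) (L t) (D t) (am t) (pbar t) - block_mat Dr 0 0 Dt *v \<phi> t"
    using sol by blast
  interpret mv: bounded_bilinear "(*v) :: real^3^3 \<Rightarrow> real^3 \<Rightarrow> real^3"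
    by (rule bounded_bilinear_matrix_vector_mult)
  interpret tr: bounded_linear "transpose :: real^3^3 \<Rightarrow> real^3^3" by (rule bounded_linear_transpose)
  interpret cr: bounded_bilinear cross3 by (rule bounded_bilinear_cross3)
  let ?\<omega> = "upper (\<phi> t)" and ?\<upsilon> = "lower (\<phi> t)"
  \<comment> \<open>The transpose of \<open>ad\<close> contributes
    \<open>- \<upsilon> \<times> M \<upsilon>\<close> to the angular equation; anticommutativity
    turns it into the first term of \<open>rotational_force\<close>.\<close>
  have "J *v upper \<phi>' = rotational_force M \<kappa> W d\<Phi> (g t) (L t) (D t) (am t) (pbar t) ?\<upsilon> - cross3 ?\<omega> (J *v ?\<omega>) - Dr *v ?\<omega> \<and>
      M *v lower \<phi>' = translational_force \<kappa> (g t) (am t) (pbar t) - cross3 ?\<omega> (M *v ?\<upsilon>) - Dt *v ?\<upsilon>"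
    using eq cross_skew[of ?\<upsilon> "M *v ?\<upsilon>"]
    by (simp add: block_mat_mult_vec ad_star_def ad_def transpose_block_mat transpose_cross_mat tr.zero
        Z_term_def Let_def block_vec_diff cross_mat_mult_vec mv.minus_left rotational_force_def
        translational_force_def cr.diff_right cr.add_right scaleR_diff_right scaleR_add_right
        del: transpose_matrix_vector)
  then have "upper \<phi>' = rotational_rate t (g t) (\<phi> t)" "lower \<phi>' = translational_rate t (g t) (\<phi> t)"
    unfolding rotational_rate_def translational_rate_def momentum_rate_def
    using matrix_inv_mult_vec(2)[OF pos_def_invertible[OF J(2)]] matrix_inv_mult_vec(2)[OF pos_def_invertible[OF M]]
    by metis+
  then show "((\<lambda>t. upper (\<phi> t)) has_vector_derivative rotational_rate t (g t) (\<phi> t)) (at t within {t0..T})"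
    "((\<lambda>t. lower (\<phi> t)) has_vector_derivative translational_rate t (g t) (\<phi> t)) (at t within {t0..T})"
    using bounded_linear.has_vector_derivative[OF bounded_linear_upper \<phi>']
      bounded_linear.has_vector_derivative[OF bounded_linear_lower \<phi>'] by simp_all
  show "continuous (at t within {t0..T}) \<phi>" using \<phi>' by (rule has_vector_derivative_continuous)
qed

section \<open>Regularity of the exact solution and invertibility near it\<close>

lemma continuous_on_exact: "continuous_on {t0..T} g" "continuous_on {t0..T} \<phi>"
  unfolding continuous_on_eq_continuous_within
  by (blast intro: has_vector_derivative_continuous[OF exact_solution(3)])
     (blast intro: exact_solution(6))

text \<open>Over the compact set of times and unit vectors, injectivity of poses gives
  \<open>norm (g t *v z)\<close> a positive minimum \<open>\<mu>\<close>, and a perturbation of size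
  \<open>m\<close> lowers it by at most \<open>K * m\<close>. Taking
  \<open>\<mu> = m + K * m\<close> lets one number be both the radius and the lower bound.\<close>

lemma invertible_near_exact:
  obtains m where "0 < m"
    "\<And>t h z. t \<in> {t0..T} \<Longrightarrow> norm (h - g t) \<le> m \<Longrightarrow> m * norm z \<le> norm (h *v z)"
proof -
  interpret mv: bounded_bilinear "(*v) :: pose \<Rightarrow> real^(3+1) \<Rightarrow> real^(3+1)"
    by (rule bounded_bilinear_matrix_vector_mult)
  obtain K where K: "0 \<le> K" "\<And>A z. norm ((A::pose) *v z) \<le> norm A * norm z * K"
    using mv.nonneg_bounded by blast
  let ?S = "{t0..T} \<times> sphere (0 :: real^(3+1)) 1"
  have "continuous_on ?S (\<lambda>q. g (fst q))"
    by (rule continuous_on_compose2[OF continuous_on_exact(1)]) (auto intro: continuous_on_fst)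
  then have cont: "continuous_on ?S (\<lambda>q. norm (g (fst q) *v snd q))"
    by (intro continuous_on_norm mv.continuous_on continuous_on_snd continuous_on_id)
  have "compact ?S" by (intro compact_Times compact_Icc compact_sphere)
  moreover have "?S \<noteq> {}" using t0_less_T by simp
  ultimately have "\<exists>q\<in>?S. \<forall>p\<in>?S. norm (g (fst q) *v snd q) \<le> norm (g (fst p) *v snd p)"
    using cont by (rule continuous_attains_inf)
  then obtain q where q: "q \<in> ?S" "\<And>p. p \<in> ?S \<Longrightarrow> norm (g (fst q) *v snd q) \<le> norm (g (fst p) *v snd p)"
    by blast
  define \<mu> where "\<mu> = norm (g (fst q) *v snd q)"
  have "0 < \<mu>"
  proof (rule ccontr)
    assume "\<not> 0 < \<mu>"
    then have "g (fst q) *v snd q = 0" by (simp add: \<mu>_def)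
    moreover have "g (fst q) \<in> SE3" using q(1) by (intro exact_solution(1)) auto
    ultimately have "snd q = 0" by (rule SE3_injective[rotated])
    then show False using q(1) by auto
  qed
  have below: "\<mu> * norm z \<le> norm (g t *v z)" if "t \<in> {t0..T}" for t z
  proof (cases "z = 0")
    case False
    then have "\<mu> \<le> norm (g t *v (z /\<^sub>R norm z))"
      unfolding \<mu>_def using q(2)[of "(t, z /\<^sub>R norm z)"] that by simp
    then show ?thesis using False by (simp add: mv.scaleR_right field_simps)
  qed simp
  define m where "m = \<mu> / (K + 1)"
  have "m * (K + 1) = \<mu>" using K(1) by (simp add: m_def)
  then have "\<mu> = m + K * m" by (simp add: algebra_simps)
  moreover have "0 < m" using \<open>0 < \<mu>\<close> K(1) by (simp add: m_def)
  ultimately have m: "0 < m" "\<mu> = m + K * m" by blast+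
  have "m * norm z \<le> norm (h *v z)" if "t \<in> {t0..T}" "norm (h - g t) \<le> m" for t h z
  proof -
    have "norm ((h - g t) *v z) \<le> m * norm z * K"
      by (rule order_trans[OF K(2)]) (intro mult_right_mono that K norm_ge_zero)
    moreover have "norm (g t *v z) \<le> norm (h *v z) + norm ((h - g t) *v z)"
      using norm_triangle_ineq4[of "h *v z" "(h - g t) *v z"] by (simp add: mv.diff_left)
    ultimately show ?thesis using below[OF that(1), of z] by (simp add: m(2) algebra_simps)
  qed
  with m(1) show ?thesis by (rule that)
qed

lemma exact_bounded: "ubounded {t0..T} g" "ubounded {t0..T} \<phi>"
  by (intro ubounded_continuous continuous_on_exact)+

text \<open>A bootstrap: continuity bounds the rates on the compact interval, bounded rates make the
  solution Lipschitz, and in \<open>exact_taylor\<close> this makes the rates Lipschitz in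
  time.\<close>

lemma exact_lipschitz: "\<exists>B. B-lipschitz_on {t0..T} g" "\<exists>B. B-lipschitz_on {t0..T} \<phi>"
proof -
  obtain m where m: "0 < m" "\<And>t h z. t \<in> {t0..T} \<Longrightarrow> norm (h - g t) \<le> m \<Longrightarrow> m * norm z \<le> norm (h *v z)"
    by (rule invertible_near_exact) blast
  have m': "m * norm z \<le> norm (g t *v z)" if "t \<in> {t0..T}" for t z
    using m(2)[OF that, of "g t"] m(1) by simp
  note rates = uclose_rates[of "{t0..T}" "\<lambda>t. t" "\<lambda>t. t" "\<lambda>_. 1", OF _ _ _ uclose_refl[OF exact_bounded(1)]
      uclose_refl[OF exact_bounded(2)] m(1) m' m', THEN ucloseD(1), simplified]
  show "\<exists>B. B-lipschitz_on {t0..T} g"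
    by (rule lipschitz_if_bounded_derivative[OF exact_solution(3) rates(2)])
  obtain B1 where B1: "B1-lipschitz_on {t0..T} (\<lambda>t. upper (\<phi> t))"
    using lipschitz_if_bounded_derivative[OF exact_solution(4) rates(3)] by blast
  obtain B2 where B2: "B2-lipschitz_on {t0..T} (\<lambda>t. lower (\<phi> t))"
    using lipschitz_if_bounded_derivative[OF exact_solution(5) rates(4)] by blast
  have "(B1 + B2)-lipschitz_on {t0..T} \<phi>"
  proof (rule lipschitz_onI)
    fix s t assume st: "s \<in> {t0..T}" "t \<in> {t0..T}"
    have "norm (\<phi> s - \<phi> t) \<le> norm (upper (\<phi> s - \<phi> t)) + norm (lower (\<phi> s - \<phi> t))"
      by (rule norm_le_upper_lower)
    then show "dist (\<phi> s) (\<phi> t) \<le> (B1 + B2) * dist s t"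
      using lipschitz_onD[OF B1 st] lipschitz_onD[OF B2 st]
      by (simp add: dist_norm linear_diff[OF bounded_linear.linear] bounded_linear_upper bounded_linear_lower algebra_simps)
  qed (use lipschitz_on_nonneg[OF B1] lipschitz_on_nonneg[OF B2] in simp)
  then show "\<exists>B. B-lipschitz_on {t0..T} \<phi>" ..
qed

lemma exact_taylor:
  assumes Q: "\<And>q. q \<in> Q \<Longrightarrow> t0 \<le> t q" "\<And>q. q \<in> Q \<Longrightarrow> 0 < h q" "\<And>q. q \<in> Q \<Longrightarrow> t q + h q \<le> T"
  shows "ubigo Q (\<lambda>q. (h q)\<^sup>2) (\<lambda>q. g (t q + h q) - g (t q) - h q *\<^sub>R pose_rate (t q) (g (t q)) (\<phi> (t q)))"
    "ubigo Q (\<lambda>q. (h q)\<^sup>2) (\<lambda>q. upper (\<phi> (t q + h q)) - upper (\<phi> (t q)) - h q *\<^sub>R rotational_rate (t q) (g (t q)) (\<phi> (t q)))"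
    "ubigo Q (\<lambda>q. (h q)\<^sup>2) (\<lambda>q. lower (\<phi> (t q + h q)) - lower (\<phi> (t q)) - h q *\<^sub>R translational_rate (t q) (g (t q)) (\<phi> (t q)))"
proof -
  obtain m where m: "0 < m" "\<And>t h z. t \<in> {t0..T} \<Longrightarrow> norm (h - g t) \<le> m \<Longrightarrow> m * norm z \<le> norm (h *v z)"
    by (rule invertible_near_exact) blast
  have m': "m * norm z \<le> norm (g t *v z)" if "t \<in> {t0..T}" for t z
    using m(2)[OF that, of "g t"] m(1) by simp
  obtain B1 B2 where B: "B1-lipschitz_on {t0..T} g" "B2-lipschitz_on {t0..T} \<phi>" using exact_lipschitz by blast
  let ?I2 = "{t0..T} \<times> {t0..T}" and ?r = "\<lambda>q::real\<times>real. \<bar>fst q - snd q\<bar>"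
  have close: "uclose ?I2 ?r (\<lambda>q. g (fst q)) (\<lambda>q. g (snd q))" "uclose ?I2 ?r (\<lambda>q. \<phi> (fst q)) (\<lambda>q. \<phi> (snd q))"
    by (auto intro!: uclose_lipschitz[OF B(1)] uclose_lipschitz[OF B(2)])
  have "m * norm z \<le> norm (g (fst q) *v z)" "m * norm z \<le> norm (g (snd q) *v z)" if "q \<in> ?I2" for q z
    using that by (auto intro: m')
  note rates = uclose_rates[of ?I2 fst snd ?r, OF _ _ _ close m(1) this]
  have lip: "\<exists>B. B-lipschitz_on {t0..T} (\<lambda>t. pose_rate t (g t) (\<phi> t))"
    "\<exists>B. B-lipschitz_on {t0..T} (\<lambda>t. rotational_rate t (g t) (\<phi> t))"
    "\<exists>B. B-lipschitz_on {t0..T} (\<lambda>t. translational_rate t (g t) (\<phi> t))"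
    using rates(2-4) by (auto intro!: lipschitz_if_uclose)
  note taylor = ubigo_taylor[OF _ _ Q]
  show "ubigo Q (\<lambda>q. (h q)\<^sup>2) (\<lambda>q. g (t q + h q) - g (t q) - h q *\<^sub>R pose_rate (t q) (g (t q)) (\<phi> (t q)))"
    by (rule taylor[OF exact_solution(3) lip(1)])
  show "ubigo Q (\<lambda>q. (h q)\<^sup>2) (\<lambda>q. upper (\<phi> (t q + h q)) - upper (\<phi> (t q)) - h q *\<^sub>R rotational_rate (t q) (g (t q)) (\<phi> (t q)))"
    by (rule taylor[OF exact_solution(4) lip(2)])
  show "ubigo Q (\<lambda>q. (h q)\<^sup>2) (\<lambda>q. lower (\<phi> (t q + h q)) - lower (\<phi> (t q)) - h q *\<^sub>R translational_rate (t q) (g (t q)) (\<phi> (t q)))"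
    by (rule taylor[OF exact_solution(5) lip(3)])
qed

text \<open>The summands match the three update formulas, so the one-step inequalities add up with
  the factor 1 in front of the old error intact. \<open>\<xi>\<close> is absent because the
  invariant determines it.\<close>

definition state_error :: "real \<Rightarrow> pose \<Rightarrow> twist \<Rightarrow> real" where
  "state_error t p \<psi> = norm (p - g t) + norm (upper \<psi> - upper (\<phi> t)) + norm (lower \<psi> - lower (\<phi> t))"

lemma state_error_ge:
  "norm (p - g t) \<le> state_error t p \<psi>" "norm (\<psi> - \<phi> t) \<le> state_error t p \<psi>" "0 \<le> state_error t p \<psi>"
proof -
  have "norm (\<psi> - \<phi> t) \<le> norm (upper (\<psi> - \<phi> t)) + norm (lower (\<psi> - \<phi> t))" by (rule norm_le_upper_lower)
  then have "norm (\<psi> - \<phi> t) \<le> norm (upper \<psi> - upper (\<phi> t)) + norm (lower \<psi> - lower (\<phi> t))"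
    by (simp add: linear_diff[OF bounded_linear.linear] bounded_linear_upper bounded_linear_lower)
  then show "norm (\<psi> - \<phi> t) \<le> state_error t p \<psi>"
    unfolding state_error_def using norm_ge_zero[of "p - g t"] by linarith
qed (simp_all add: state_error_def)

lemma uclose_state_error:
  assumes "\<And>q. q \<in> Q \<Longrightarrow> t q \<in> {t0..T}" "\<And>q. q \<in> Q \<Longrightarrow> state_error (t q) (gx q) (\<phi>x q) \<le> 1"
  defines "e \<equiv> \<lambda>q. state_error (t q) (gx q) (\<phi>x q)"
  shows "uclose Q e gx (\<lambda>q. g (t q))" "uclose Q e \<phi>x (\<lambda>q. \<phi> (t q))"
proof -
  have e1: "e q \<le> 1" if "q \<in> Q" for q using assms(2)[OF that] by (simp add: e_def)
  show "uclose Q e gx (\<lambda>q. g (t q))"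
  proof (rule uclose_perturb[OF ubigo_compose[OF exact_bounded(1) assms(1)] _ e1])
    show "ubigo Q e (\<lambda>q. gx q - g (t q))"
      unfolding e_def by (rule ubigoI[where C=1]) (simp_all add: state_error_ge)
  qed
  show "uclose Q e \<phi>x (\<lambda>q. \<phi> (t q))"
  proof (rule uclose_perturb[OF ubigo_compose[OF exact_bounded(2) assms(1)] _ e1])
    show "ubigo Q e (\<lambda>q. \<phi>x q - \<phi> (t q))"
      unfolding e_def by (rule ubigoI[where C=1]) (simp_all add: state_error_ge)
  qed
qed

text \<open>A step is given by functions on \<open>Q\<close>, so \<open>K\<close> and
  \<open>C\<close> are common to all of \<open>Q\<close>. The new forces depend on the new pose, the
  rotational one also on the new linear velocity; hence \<open>g1\<close> has to precede
  \<open>v2\<close>, and \<open>v1\<close> has to precede \<open>w2\<close>.\<close>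

lemma step_error:
  fixes Q :: "'q set" and t h :: "'q \<Rightarrow> real" and gx gx' :: "'q \<Rightarrow> pose" and \<phi>x \<phi>x' :: "'q \<Rightarrow> twist"
    and F :: "'q \<Rightarrow> real^3^3"
  assumes m: "0 < m" "\<And>t h z. t \<in> {t0..T} \<Longrightarrow> norm (h - g t) \<le> m \<Longrightarrow> m * norm z \<le> norm (h *v z)"
    and th: "\<And>q. q \<in> Q \<Longrightarrow> t0 \<le> t q" "\<And>q. q \<in> Q \<Longrightarrow> 0 < h q" "\<And>q. q \<in> Q \<Longrightarrow> t q + h q \<le> T"
      "\<And>q. q \<in> Q \<Longrightarrow> h q \<le> 1"
    and e: "\<And>q. q \<in> Q \<Longrightarrow> state_error (t q) (gx q) (\<phi>x q) \<le> min 1 m"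
    and F: "ubigo Q (\<lambda>q. (h q)\<^sup>2) (\<lambda>q. F q - mat 1 - h q *\<^sub>R cross_mat (upper (\<phi>x q)))"
    and \<upsilon>: "\<And>q. q \<in> Q \<Longrightarrow> (M + h q *\<^sub>R Dt) *v lower (\<phi>x' q) = transpose (F q) *v (M *v lower (\<phi>x q))
          + h q *\<^sub>R translational_force \<kappa> (gx' q) (am (t q + h q)) (pbar (t q + h q))"
    and \<omega>: "\<And>q. q \<in> Q \<Longrightarrow> (J + h q *\<^sub>R Dr) *v upper (\<phi>x' q) = transpose (F q) *v (J *v upper (\<phi>x q))
          + h q *\<^sub>R rotational_force M \<kappa> W d\<Phi> (gx' q) (L (t q + h q)) (D (t q + h q)) (am (t q + h q))
              (pbar (t q + h q)) (lower (\<phi>x' q))"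
    and gx': "\<And>q. q \<in> Q \<Longrightarrow> gx' q = gx q ** mat_exp (h q *\<^sub>R vee (velocity_estimate (xim (t q)) (gx q) (\<phi>x q)))"
  shows "\<exists>K\<ge>0. \<exists>C\<ge>0. \<forall>q\<in>Q. state_error (t q + h q) (gx' q) (\<phi>x' q)
      \<le> (1 + K * h q) * state_error (t q) (gx q) (\<phi>x q) + C * (h q)\<^sup>2"
proof -
  define e where "e q = state_error (t q) (gx q) (\<phi>x q)" for q
  have e0: "0 \<le> e q" for q by (simp add: e_def state_error_ge)
  have tT: "t q \<in> {t0..T}" "t q + h q \<in> {t0..T}" if "q \<in> Q" for q
    using th(1-3)[OF that] by auto
  have h0: "\<And>q. q \<in> Q \<Longrightarrow> 0 \<le> h q" using th(2) by (simp add: less_imp_le)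
  have close: "uclose Q e gx (\<lambda>q. g (t q))" "uclose Q e \<phi>x (\<lambda>q. \<phi> (t q))"
    unfolding e_def[abs_def] using tT e by (auto intro!: uclose_state_error)
  have gx_m: "m * norm z \<le> norm (gx q *v z)" if "q \<in> Q" for q z
    using e[OF that] by (intro m(2)[OF tT(1)[OF that]] order_trans[OF state_error_ge(1)[of _ _ "\<phi>x q"]]) simp
  have g_m: "m * norm z \<le> norm (g (t q) *v z)" if "q \<in> Q" for q z
    by (rule m(2)[OF tT(1)[OF that]]) (use m(1) in simp)
  have "\<bar>t q - t q\<bar> \<le> e q" for q using e0 by simp
  note rates = uclose_rates[OF tT(1) tT(1) this close m(1) gx_m g_m]
  have bd: "ubounded Q gx" "ubounded Q \<phi>x" using close ucloseD by blast+
  have bdu: "ubounded Q (\<lambda>q. upper (\<phi>x q))" "ubounded Q (\<lambda>q. lower (\<phi>x q))"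
    using bd(2) by (rule ubigo_linear[OF bounded_linear_upper], rule ubigo_linear[OF bounded_linear_lower])
  have "\<bar>(t q + h q) - t q\<bar> \<le> h q" if "q \<in> Q" for q using h0[OF that] by simp
  note data = uclose_data[OF tT(2) tT(1) this]
  have g2: "ubigo Q (\<lambda>q. (h q)\<^sup>2) (\<lambda>q. gx' q - gx q - h q *\<^sub>R pose_rate (t q) (gx q) (\<phi>x q))"
    unfolding pose_rate_def
    by (rule pose_update[OF th(2,4) bd(1) ubigo_linear[OF bounded_linear_vee ucloseD(1)[OF rates(1)]] gx'])
  have g1: "uclose Q h gx' gx"
    by (rule uclose_perturb[OF bd(1) ubigo_increment[OF th(2,4) g2 ucloseD(1)[OF rates(2)]] th(4)])
  have tf: "uclose Q h (\<lambda>q. translational_force \<kappa> (gx' q) (am (t q + h q)) (pbar (t q + h q)))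
      (\<lambda>q. translational_force \<kappa> (gx q) (am (t q)) (pbar (t q)))"
    by (rule uclose_translational_force[OF g1 data(4,5)])
  have v2: "ubigo Q (\<lambda>q. (h q)\<^sup>2) (\<lambda>q. lower (\<phi>x' q) - lower (\<phi>x q) - h q *\<^sub>R translational_rate (t q) (gx q) (\<phi>x q))"
    unfolding translational_rate_def
    by (rule momentum_update[OF M Dt th(2,4) bdu(2) bdu(1) ucloseD(2,3)[OF tf] F \<upsilon>])
  have v1: "uclose Q h (\<lambda>q. lower (\<phi>x' q)) (\<lambda>q. lower (\<phi>x q))"
    by (rule uclose_perturb[OF bdu(2) ubigo_increment[OF th(2,4) v2 ucloseD(1)[OF rates(4)]] th(4)])
  have rf: "uclose Q h (\<lambda>q. rotational_force M \<kappa> W d\<Phi> (gx' q) (L (t q + h q)) (D (t q + h q)) (am (t q + h q))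
              (pbar (t q + h q)) (lower (\<phi>x' q)))
      (\<lambda>q. rotational_force M \<kappa> W d\<Phi> (gx q) (L (t q)) (D (t q)) (am (t q)) (pbar (t q)) (lower (\<phi>x q)))"
    by (rule uclose_rotational_force[OF W d\<Phi> g1 data(2-5) v1])
  have w2: "ubigo Q (\<lambda>q. (h q)\<^sup>2) (\<lambda>q. upper (\<phi>x' q) - upper (\<phi>x q) - h q *\<^sub>R rotational_rate (t q) (gx q) (\<phi>x q))"
    unfolding rotational_rate_def
    by (rule momentum_update[OF J(2) Dr th(2,4) bdu(1) bdu(1) ucloseD(2,3)[OF rf] F \<omega>])
  note taylor = exact_taylor[OF th(1-3)]
  obtain K1 C1 where 1: "0 \<le> K1" "0 \<le> C1" "\<And>q. q \<in> Q \<Longrightarrow> norm (gx' q - g (t q + h q)) \<le>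
      norm (gx q - g (t q)) + K1 * h q * e q + C1 * (h q)\<^sup>2"
    using one_step_error[OF h0 g2 taylor(1) ucloseD(3)[OF rates(2)]] by blast
  obtain K2 C2 where 2: "0 \<le> K2" "0 \<le> C2" "\<And>q. q \<in> Q \<Longrightarrow> norm (upper (\<phi>x' q) - upper (\<phi> (t q + h q))) \<le>
      norm (upper (\<phi>x q) - upper (\<phi> (t q))) + K2 * h q * e q + C2 * (h q)\<^sup>2"
    using one_step_error[OF h0 w2 taylor(2) ucloseD(3)[OF rates(3)]] by blast
  obtain K3 C3 where 3: "0 \<le> K3" "0 \<le> C3" "\<And>q. q \<in> Q \<Longrightarrow> norm (lower (\<phi>x' q) - lower (\<phi> (t q + h q))) \<le>
      norm (lower (\<phi>x q) - lower (\<phi> (t q))) + K3 * h q * e q + C3 * (h q)\<^sup>2"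
    using one_step_error[OF h0 v2 taylor(3) ucloseD(3)[OF rates(4)]] by blast
  have "state_error (t q + h q) (gx' q) (\<phi>x' q) \<le> (1 + (K1 + K2 + K3) * h q) * e q + (C1 + C2 + C3) * (h q)\<^sup>2"
    if "q \<in> Q" for q
    using add_mono[OF add_mono[OF 1(3)[OF that] 2(3)[OF that]] 3(3)[OF that]]
    by (simp add: state_error_def e_def algebra_simps)
  then show ?thesis
    using 1 2 3 unfolding e_def
    by (intro exI[of _ "K1 + K2 + K3"] conjI exI[of _ "C1 + C2 + C3"] ballI) auto
qed

lemma estimator_step_order:
  "\<exists>\<epsilon>0>0. \<forall>\<epsilon>. 0 < \<epsilon> \<and> \<epsilon> \<le> \<epsilon>0 \<longrightarrow>
    one_step_order 1 (estimator_step J M Dr Dt \<kappa> W d\<Phi> xim L D am pbar \<epsilon>) (\<lambda>t. (g t, \<xi> t, \<phi> t)) t0 T"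
proof -
  define \<J> where "\<J> = (1/2 * trace J) *\<^sub>R mat 1 - J"
  obtain m where m: "0 < m" "\<And>t h z. t \<in> {t0..T} \<Longrightarrow> norm (h - g t) \<le> m \<Longrightarrow> m * norm z \<le> norm (h *v z)"
    by (rule invertible_near_exact) blast
  obtain R where R: "0 \<le> R" "\<And>t. t \<in> {t0..T} \<Longrightarrow> norm (\<phi> t) \<le> R * 1"
    using exact_bounded(2) by (rule ubigoE) blast
  \<comment> \<open>Within distance 1 of the exact solution the states are uniformly bounded, within
    distance \<open>m\<close> the poses are uniformly invertible.\<close>
  define \<delta> where "\<delta> = min 1 m"
  have \<delta>: "0 < \<delta>" using m by (simp add: \<delta>_def)
  have upper_bound: "norm (upper \<psi>) \<le> R + 1" if "t \<in> {t0..T}" "state_error t h \<psi> \<le> \<delta>" for t h \<psi>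
  proof -
    have "norm \<psi> \<le> norm (\<phi> t) + norm (\<psi> - \<phi> t)" by (rule norm_triangle_sub)
    also have "\<dots> \<le> R + 1" using R(2)[OF that(1)] state_error_ge(2)[of \<psi> t h] that(2) by (simp add: \<delta>_def)
    finally show ?thesis using norm_upper_le[of \<psi>] by simp
  qed
  obtain \<epsilon>0 where "0 < \<epsilon>0" and \<epsilon>0: "\<exists>h1>0. \<exists>C\<ge>0. \<forall>h \<omega> F. 0 < h \<and> h \<le> h1 \<and> norm \<omega> \<le> R + 1 \<and>
      rotation_matrix F \<and> norm (F - mat_exp (h *\<^sub>R cross_mat \<omega>)) < \<epsilon>0 \<and>
      cross_mat (J *v \<omega>) = (1 / h) *\<^sub>R (F ** \<J> - \<J> ** transpose F) \<longrightarrow>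
      norm (F - mat 1 - h *\<^sub>R cross_mat \<omega>) \<le> C * h\<^sup>2"
    using attitude_increment_expansion[OF J, folded \<J>_def] R(1) by (metis add_nonneg_nonneg zero_le_one)
  obtain h1 C0 where h1: "0 < h1" "0 \<le> C0" and F_expansion: "\<And>h \<omega> F. 0 < h \<Longrightarrow> h \<le> h1 \<Longrightarrow> norm \<omega> \<le> R + 1 \<Longrightarrow>
      rotation_matrix F \<Longrightarrow> norm (F - mat_exp (h *\<^sub>R cross_mat \<omega>)) < \<epsilon>0 \<Longrightarrow>
      cross_mat (J *v \<omega>) = (1 / h) *\<^sub>R (F ** \<J> - \<J> ** transpose F) \<Longrightarrow>
      norm (F - mat 1 - h *\<^sub>R cross_mat \<omega>) \<le> C0 * h\<^sup>2"
    using \<epsilon>0 by blast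
  have "one_step_order 1 (estimator_step J M Dr Dt \<kappa> W d\<Phi> xim L D am pbar \<epsilon>) (\<lambda>t. (g t, \<xi> t, \<phi> t)) t0 T"
    if \<epsilon>: "0 < \<epsilon>" "\<epsilon> \<le> \<epsilon>0" for \<epsilon>
  proof -
    \<comment> \<open>Of the step-size bounds, only this one depends on \<open>\<epsilon>\<close>: a
      smaller neighbourhood of the exponential inherits the expansion of \<open>F\<close>, but it
      may contain a solution only for smaller \<open>h\<close>.\<close>
    obtain h2 where h2: "0 < h2" and F_exists: "\<And>h \<omega>. 0 < h \<Longrightarrow> h \<le> h2 \<Longrightarrow> norm \<omega> \<le> R + 1 \<Longrightarrow>
        \<exists>F. rotation_matrix F \<and> norm (F - mat_exp (h *\<^sub>R cross_mat \<omega>)) < \<epsilon> \<and>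
          cross_mat (J *v \<omega>) = (1 / h) *\<^sub>R (F ** \<J> - \<J> ** transpose F)"
      using attitude_increment_exists[OF J \<epsilon>(1), of "R + 1", folded \<J>_def] R(1) by (metis add_nonneg_nonneg zero_le_one)
    define h3 where "h3 = min 1 (min h1 h2)"
    have h3: "0 < h3" using h1 h2 by (simp add: h3_def)
    define P where "P t x \<longleftrightarrow> (case x of (gx, \<xi>x, \<phi>x) \<Rightarrow> \<xi>x = velocity_estimate (xim t) gx \<phi>x)" for t and x :: "pose \<times> twist \<times> twist"
    define e where "e t x = (case x of (gx, \<xi>x, \<phi>x) \<Rightarrow> state_error t gx \<phi>x)" for t and x :: "pose \<times> twist \<times> twist"

    \<comment> \<open>All states in the tube around the exact solution. Closeness over this set
      bounds the error of \<open>\<xi>\<close> by the state error, uniformly in time.\<close>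
    define Q1 where "Q1 = {(t, gx, \<phi>x). t \<in> {t0..T} \<and> state_error t gx \<phi>x \<le> \<delta>}"
    have Q1: "fst q \<in> {t0..T}" "state_error (fst q) (fst (snd q)) (snd (snd q)) \<le> \<delta>" if "q \<in> Q1" for q
      using that by (auto simp: Q1_def)
    let ?e = "\<lambda>q. state_error (fst q) (fst (snd q)) (snd (snd q))"
    have close: "uclose Q1 ?e (\<lambda>q. fst (snd q)) (\<lambda>q. g (fst q))" "uclose Q1 ?e (\<lambda>q. snd (snd q)) (\<lambda>q. \<phi> (fst q))"
      using Q1 by (auto intro!: uclose_state_error simp: \<delta>_def)
    have "m * norm z \<le> norm (fst (snd q) *v z)" "m * norm z \<le> norm (g (fst q) *v z)" if "q \<in> Q1" for q z
      using Q1[OF that] m(1) order_trans[OF state_error_ge(1) Q1(2)[OF that]]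
      by (auto intro!: m(2)[OF Q1(1)[OF that]] simp: \<delta>_def)
    from uclose_rates(1)[OF Q1(1) Q1(1) _ close m(1) this]
    have "uclose Q1 ?e (\<lambda>q. velocity_estimate (xim (fst q)) (fst (snd q)) (snd (snd q)))
        (\<lambda>q. velocity_estimate (xim (fst q)) (g (fst q)) (\<phi> (fst q)))"
      by (simp add: state_error_ge)
    from ucloseD(3)[OF this] obtain K where K: "0 \<le> K" "\<And>q. q \<in> Q1 \<Longrightarrow> norm (velocity_estimate (xim (fst q)) (fst (snd q)) (snd (snd q))
        - velocity_estimate (xim (fst q)) (g (fst q)) (\<phi> (fst q))) \<le> K * ?e q"
      by (rule ubigoE) blast

    \<comment> \<open>A point is a whole admissible step together with its \<open>F\<close>, with
      \<open>\<xi>\<close> replaced by its value from the invariant. Applying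
      \<open>step_error\<close> to the coordinate projections gives constants valid for all steps at
      once.\<close>
    define Q2 where "Q2 = {(t, h, gx, \<phi>x, gx', \<phi>x', F). 0 < h \<and> h \<le> h3 \<and> t0 \<le> t \<and> t + h \<le> T \<and>
       state_error t gx \<phi>x \<le> \<delta> \<and> rotation_matrix F \<and> norm (F - mat_exp (h *\<^sub>R cross_mat (upper \<phi>x))) < \<epsilon> \<and>
       cross_mat (J *v upper \<phi>x) = (1 / h) *\<^sub>R (F ** \<J> - \<J> ** transpose F) \<and>
       (M + h *\<^sub>R Dt) *v lower \<phi>x' =
         transpose F *v (M *v lower \<phi>x) + h *\<^sub>R translational_force \<kappa> gx' (am (t + h)) (pbar (t + h)) \<and>
       (J + h *\<^sub>R Dr) *v upper \<phi>x' = transpose F *v (J *v upper \<phi>x)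
         + h *\<^sub>R rotational_force M \<kappa> W d\<Phi> gx' (L (t + h)) (D (t + h)) (am (t + h)) (pbar (t + h)) (lower \<phi>x') \<and>
       gx' = gx ** mat_exp (h *\<^sub>R vee (velocity_estimate (xim t) gx \<phi>x))}"
    have "\<exists>L\<ge>0. \<exists>C\<ge>0. \<forall>q\<in>Q2. case q of (t, h, gx, \<phi>x, gx', \<phi>x', F) \<Rightarrow>
       state_error (t + h) gx' \<phi>x' \<le> (1 + L * h) * state_error t gx \<phi>x + C * h\<^sup>2"
    proof -
      let ?t = "\<lambda>(t, h, gx, \<phi>x, gx', \<phi>x', F). t" and ?h = "\<lambda>(t, h, gx, \<phi>x, gx', \<phi>x', F). h"
      let ?gx = "\<lambda>(t, h, gx, \<phi>x, gx', \<phi>x', F). gx" and ?\<phi>x = "\<lambda>(t, h, gx, \<phi>x, gx', \<phi>x', F). \<phi>x"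
      let ?gx' = "\<lambda>(t, h, gx, \<phi>x, gx', \<phi>x', F). gx'" and ?\<phi>x' = "\<lambda>(t, h, gx, \<phi>x, gx', \<phi>x', F). \<phi>x'"
      let ?F = "\<lambda>(t, h, gx, \<phi>x, gx', \<phi>x', F). F"
      have "\<exists>K\<ge>0. \<exists>C\<ge>0. \<forall>q\<in>Q2. state_error (?t q + ?h q) (?gx' q) (?\<phi>x' q)
          \<le> (1 + K * ?h q) * state_error (?t q) (?gx q) (?\<phi>x q) + C * (?h q)\<^sup>2"
      proof (rule step_error[where F="?F", OF m])
        show "ubigo Q2 (\<lambda>q. (?h q)\<^sup>2) (\<lambda>q. ?F q - mat 1 - ?h q *\<^sub>R cross_mat (upper (?\<phi>x q)))"
        proof (rule ubigoI[OF _ h1(2)])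
          fix q assume "q \<in> Q2"
          then show "norm (?F q - mat 1 - ?h q *\<^sub>R cross_mat (upper (?\<phi>x q))) \<le> C0 * (?h q)\<^sup>2"
            using \<epsilon> by (auto simp: Q2_def h3_def intro!: F_expansion upper_bound)
        qed
      qed (auto simp: Q2_def h3_def \<delta>_def)
      then show ?thesis by (simp add: case_prod_beta)
    qed
    then obtain L' C where C: "0 \<le> L'" "0 \<le> C" "\<And>t h gx \<phi>x gx' \<phi>x' F. (t, h, gx, \<phi>x, gx', \<phi>x', F) \<in> Q2 \<Longrightarrow>
        state_error (t + h) gx' \<phi>x' \<le> (1 + L' * h) * state_error t gx \<phi>x + C * h\<^sup>2"
      by fastforce
    show ?thesis
    proof (rule one_step_order_1I[where P=P and e=e, OF \<delta> h3 _ C(1,2) t0_less_T])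
      \<comment> \<open>\<open>K\<close> accounts for \<open>\<xi>\<close>, and the pose and
        \<open>\<phi>\<close> contribute 1 each.\<close>
      show "0 \<le> K + 2" using K by simp
      show "P t (g t, \<xi> t, \<phi> t)" if "t \<in> {t0..T}" for t
        using exact_solution(2)[OF that] by (simp add: P_def)
      show "e t (g t, \<xi> t, \<phi> t) = 0" for t by (simp add: e_def state_error_def)
    next
      fix t x assume t: "t \<in> {t0..T}" and x: "P t x" "e t x \<le> \<delta>"
      obtain gx \<xi>x \<phi>x where xeq: "x = (gx, \<xi>x, \<phi>x)" by (cases x)
      have "norm (\<xi>x - \<xi> t) \<le> K * state_error t gx \<phi>x"
        using K(2)[of "(t, gx, \<phi>x)"] t x exact_solution(2)[OF t] by (simp add: xeq P_def e_def Q1_def)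
      then show "norm (x - (g t, \<xi> t, \<phi> t)) \<le> (K + 2) * e t x"
        using state_error_ge[where t=t and p=gx and \<psi>=\<phi>x] norm_Pair_le[of "gx - g t" "(\<xi>x - \<xi> t, \<phi>x - \<phi> t)"]
          norm_Pair_le[of "\<xi>x - \<xi> t" "\<phi>x - \<phi> t"]
        by (simp add: xeq e_def algebra_simps)
    next
      fix t h x assume th: "0 < h" "h \<le> h3" "t0 \<le> t" "t + h \<le> T" and x: "P t x" "e t x \<le> \<delta>"
      obtain gx \<xi>x \<phi>x where xeq: "x = (gx, \<xi>x, \<phi>x)" by (cases x)
      have "norm (upper \<phi>x) \<le> R + 1" using th x by (intro upper_bound[of t gx]) (auto simp: xeq e_def)
      then obtain F where F: "rotation_matrix F" "norm (F - mat_exp (h *\<^sub>R cross_mat (upper \<phi>x))) < \<epsilon>"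
          "cross_mat (J *v upper \<phi>x) = (1 / h) *\<^sub>R (F ** \<J> - \<J> ** transpose F)"
        using F_exists th by (auto simp: h3_def)
      note inv = matrix_inv_mult_vec(1)[OF pos_def_invertible[OF pos_def_add_scaleR[OF M Dt th(1)]]]
        matrix_inv_mult_vec(1)[OF pos_def_invertible[OF pos_def_add_scaleR[OF J(2) Dr th(1)]]]
      define gx' where "gx' = gx ** mat_exp (h *\<^sub>R vee \<xi>x)"
      define \<upsilon>' where "\<upsilon>' = matrix_inv (M + h *\<^sub>R Dt) *v (transpose F *v (M *v lower \<phi>x)
          + h *\<^sub>R translational_force \<kappa> gx' (am (t + h)) (pbar (t + h)))"
      define \<omega>' where "\<omega>' = matrix_inv (J + h *\<^sub>R Dr) *v (transpose F *v (J *v upper \<phi>x)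
         + h *\<^sub>R rotational_force M \<kappa> W d\<Phi> gx' (L (t + h)) (D (t + h)) (am (t + h)) (pbar (t + h)) \<upsilon>')"
      have "estimator_step J M Dr Dt \<kappa> W d\<Phi> xim L D am pbar \<epsilon> t h x
          (gx', velocity_estimate (xim (t + h)) gx' (block_vec \<omega>' \<upsilon>'), block_vec \<omega>' \<upsilon>')"
        unfolding xeq estimator_step_iff upper_block_vec lower_block_vec \<J>_def[symmetric]
        using F x inv by (intro exI[of _ F]) (simp add: gx'_def \<upsilon>'_def \<omega>'_def xeq P_def)
      then show "\<exists>x'. estimator_step J M Dr Dt \<kappa> W d\<Phi> xim L D am pbar \<epsilon> t h x x'" ..
    next
      fix t h x x' assume th: "0 < h" "h \<le> h3" "t0 \<le> t" "t + h \<le> T" and x: "P t x" "e t x \<le> \<delta>"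
        and step: "estimator_step J M Dr Dt \<kappa> W d\<Phi> xim L D am pbar \<epsilon> t h x x'"
      obtain gx \<xi>x \<phi>x where xeq: "x = (gx, \<xi>x, \<phi>x)" by (cases x)
      obtain gx' \<xi>x' \<phi>x' where xeq': "x' = (gx', \<xi>x', \<phi>x')" by (cases x')
      have "P (t + h) x'" using step by (auto simp: xeq xeq' estimator_step_iff P_def)
      moreover obtain F where "(t, h, gx, \<phi>x, gx', \<phi>x', F) \<in> Q2"
        using step th x unfolding xeq xeq' estimator_step_iff Q2_def e_def \<J>_def by auto
      from C(3)[OF this] have "e (t + h) x' \<le> (1 + L' * h) * e t x + C * h\<^sup>2" by (simp add: xeq xeq' e_def)
      ultimately show "P (t + h) x' \<and> e (t + h) x' \<le> (1 + L' * h) * e t x + C * h\<^sup>2" ..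
    qed
  qed
  then show ?thesis using \<open>0 < \<epsilon>0\<close> by blast
qed

end

theorem theorem8p3:
  fixes J M Dr Dt :: "real^3^3" and \<kappa> :: real and W :: "real^'n^'n"
    and \<Phi> d\<Phi> dd\<Phi> :: "real \<Rightarrow> real"
    and xim :: "real \<Rightarrow> twist" and L D :: "real \<Rightarrow> real^'n^3" and am pbar :: "real \<Rightarrow> real^3"
    and t0 T :: real and g0 :: pose and \<xi>0 :: twist
    and g :: "real \<Rightarrow> pose" and \<xi> \<phi> :: "real \<Rightarrow> twist"
  assumes "sym_mat J" "pos_def J" "sym_mat M" "pos_def M" "pos_def Dr" "pos_def Dt"
    and "0 < \<kappa>" and "sym_mat W" "pos_def W"
    and "\<And>x. 0 \<le> x \<Longrightarrow> 0 \<le> \<Phi> x" and "\<Phi> 0 = 0" and "\<And>x. 0 \<le> x \<Longrightarrow> 0 < d\<Phi> x"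
    and "\<And>x. 0 \<le> x \<Longrightarrow> (\<Phi> has_real_derivative d\<Phi> x) (at x within {0..})"
    and "\<And>x. 0 \<le> x \<Longrightarrow> (d\<Phi> has_real_derivative dd\<Phi> x) (at x within {0..})"
    and "continuous_on {0..} dd\<Phi>"
    and "t0 < T"
    and "\<And>t. t \<in> {t0..T} \<Longrightarrow> rank (D t) = 3"
    and "\<exists>B. B-lipschitz_on {t0..T} xim" "\<exists>B. B-lipschitz_on {t0..T} L"
    and "\<exists>B. B-lipschitz_on {t0..T} D" "\<exists>B. B-lipschitz_on {t0..T} am"
    and "\<exists>B. B-lipschitz_on {t0..T} pbar"
    and "estimator_solution J M Dr Dt \<kappa> W d\<Phi> xim L D am pbar {t0..T} g \<xi> \<phi>"
    and "g t0 = g0" "\<xi> t0 = \<xi>0"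
  shows "\<exists>\<epsilon>0>0. \<forall>\<epsilon>. 0 < \<epsilon> \<and> \<epsilon> \<le> \<epsilon>0 \<longrightarrow>
    one_step_order 1 (estimator_step J M Dr Dt \<kappa> W d\<Phi> xim L D am pbar \<epsilon>)
      (\<lambda>t. (g t, \<xi> t, \<phi> t)) t0 T"
proof -
  interpret estimator J M Dr Dt \<kappa> W d\<Phi> dd\<Phi> xim L D am pbar t0 T g \<xi> \<phi>
    by (rule estimator.intro) (fact assms)+
  show ?thesis by (rule estimator_step_order)
qed

end
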